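(* Let $X$ be a $d$-dimensional simplicial complex ($d\ge1$) on a vertex set $V$ with $|V|=n$, having a complete skeleton. Fix $\alpha\in\mathbb{R}$ and let $\rho_\alpha=\|(\alpha I-\Delta^+)|_{Z_{d-1}}\|$, i.e. the maximal absolute value of an eigenvalue of $\alpha I-\Delta^+$ restricted to $Z_{d-1}$ (equivalently, writing $\operatorname{Spec}(\alpha I-\Delta^+)=\{\mu_0\ge\mu_1\ge\dots\ge\mu_m\}$ with $m=\binom{n}{d}-1$, $\rho_\alpha=\max\{|\mu_{\binom{n-1}{d-1}}|,|\mu_m|\}$). Then for any pairwise disjoint sets of vertices $A_0,\dots,A_d\subseteq V$ (not necessarily a partition), \[\left|\,|F(A_0,\dots,A_d)|-\frac{\alpha\,|A_0|\cdots|A_d|}{n}\right|\le\rho_\alpha\,(|A_0|\cdots|A_d|)^{\frac{d}{d+1}}.\]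
   Context: A simplicial complex $X$ on vertex set $V$ is a family of subsets of $V$ closed under taking subsets; $X^j$ is the set of $j$-cells (cells of size $j+1$), $X^{-1}=\{\varnothing\}$. $X$ has a complete skeleton if every subset of $V$ of size at most $d$ is a cell. For $j\ge1$ an oriented $j$-cell is a $j$-cell with an ordering of its vertices up to even permutations, written $[\sigma_0,\dots,\sigma_j]$; $\overline\sigma$ is the opposite orientation. $\Omega^j$ is the space of real functions $f$ on oriented $j$-cells with $f(\overline\sigma)=-f(\sigma)$, with inner product $\langle f,g\rangle=\sum_{\sigma\in X^j}f(\sigma)g(\sigma)$. For oriented $\sigma=[\sigma_0,\dots,\sigma_{j-1}]$ and $v\notin\sigma$ with $\sigma\cup\{v\}\in X$ write $v\sim\sigma$, $v\sigma=[v,\sigma_0,\dots,\sigma_{j-1}]$. $\partial_j:\Omega^j\to\Omega^{j-1}$, $(\partial_jf)(\sigma)=\sum_{v\sim\sigma}f(v\sigma)$; its adjoint $\partial_j^*:\Omega^{j-1}\to\Omega^j$, $(\partial_j^*f)([\sigma_0,\dots,\sigma_j])=\sum_{i=0}^j(-1)^if([\sigma_0,\dots,\widehat{\sigma_i},\dots,\sigma_j])$. The upper Laplacian is $\Delta^+=\partial_d\partial_d^*$ on $\Omega^{d-1}$, and $Z_{d-1}=\ker\partial_{d-1}\subseteq\Omega^{d-1}$, which is $\Delta^+$-invariant. For disjoint $A_0,\dots,A_d\subseteq V$, $F(A_0,\dots,A_d)$ is the set of $d$-cells of $X$ with exactly one vertex in each $A_i$. *)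

theory Defs
  imports Complex_Main "HOL-Combinatorics.Permutations" "HOL-Library.Disjoint_Sets"
begin

definition simplicial_complex :: "'a set \<Rightarrow> 'a set set \<Rightarrow> bool" where
  "simplicial_complex V X \<longleftrightarrow>
     finite V \<and> X \<subseteq> Pow V \<and> (\<forall>\<sigma>\<in>X. \<forall>\<tau>. \<tau> \<subseteq> \<sigma> \<longrightarrow> \<tau> \<in> X)"

definition cells :: "'a set set \<Rightarrow> nat \<Rightarrow> 'a set set" where
  "cells X j = {\<sigma> \<in> X. card \<sigma> = j + 1}"

definition has_dimension :: "'a set set \<Rightarrow> nat \<Rightarrow> bool" where
  "has_dimension X d \<longleftrightarrow> cells X d \<noteq> {} \<and> (\<forall>\<sigma>\<in>X. card \<sigma> \<le> d + 1)"

definition complete_skeleton :: "'a set \<Rightarrow> 'a set set \<Rightarrow> nat \<Rightarrow> bool" where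
  "complete_skeleton V X d \<longleftrightarrow> (\<forall>\<sigma>. \<sigma> \<subseteq> V \<and> card \<sigma> \<le> d \<longrightarrow> \<sigma> \<in> X)"

text \<open>The orderings of the cells with \<open>k\<close> vertices. The oriented cell
  \<open>[\<sigma>\<^sub>0, \<dots>, \<sigma>\<^sub>j]\<close> is represented by any ordering in its class modulo even
  permutations. The index is the number of vertices \<open>k = j + 1\<close> rather than the
  dimension \<open>j\<close>, because \<open>j = - 1\<close> occurs; the only ordering of the empty cell
  is the empty list.\<close>

definition ordered_cells :: "'a set set \<Rightarrow> nat \<Rightarrow> 'a list set" where
  "ordered_cells X k = {\<sigma>. distinct \<sigma> \<and> set \<sigma> \<in> X \<and> length \<sigma> = k}"

text \<open>\<open>forms X k\<close> is \<open>\<Omega>\<^sup>j\<close> for \<open>k = j + 1\<close>. A function on oriented cells is a function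
  on orderings that is invariant under even permutations; the condition
  \<open>f(\<sigma>') = - f(\<sigma>)\<close> for the opposite orientation \<open>\<sigma>'\<close> says that odd permutations
  change its sign. For \<open>k \<le> 1\<close> there are no odd permutations, so all
  functions on vertices, and all functions on the empty cell, are included.
  Forms are extended by zero to the lists that are not orderings of a cell, so that
  equality of forms is equality of functions.\<close>

definition forms :: "'a set set \<Rightarrow> nat \<Rightarrow> ('a list \<Rightarrow> real) set" where
  "forms X k = {f.
     (\<forall>\<sigma>. \<sigma> \<notin> ordered_cells X k \<longrightarrow> f \<sigma> = 0) \<and>
     (\<forall>\<sigma> \<in> ordered_cells X k. \<forall>p. p permutes {..<k} \<longrightarrow>
        f (permute_list p \<sigma>) = (if evenperm p then f \<sigma> else - f \<sigma>))}"

text \<open>One constant serves for the operators \<open>\<partial>\<^sub>j\<close> of all dimensions: as forms vanish off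
  \<open>ordered_cells X k\<close>, it maps \<open>forms X (k + 1)\<close> to \<open>forms X k\<close>. The same holds for
  \<open>coboundary\<close> (the adjoint \<open>\<partial>\<^sub>j\<^sup>*\<close>) in the other direction; there the case distinction
  is what makes the result vanish on lists that are not orderings of a cell.\<close>

definition boundary :: "'a set set \<Rightarrow> ('a list \<Rightarrow> real) \<Rightarrow> 'a list \<Rightarrow> real" where
  "boundary X f \<sigma> = (\<Sum>v | v \<notin> set \<sigma> \<and> insert v (set \<sigma>) \<in> X. f (v # \<sigma>))"

definition coboundary :: "'a set set \<Rightarrow> ('a list \<Rightarrow> real) \<Rightarrow> 'a list \<Rightarrow> real" where
  "coboundary X f \<sigma> =
     (if distinct \<sigma> \<and> set \<sigma> \<in> X
      then \<Sum>i<length \<sigma>. (- 1) ^ i * f (take i \<sigma> @ drop (Suc i) \<sigma>)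
      else 0)"

definition upper_laplacian :: "'a set set \<Rightarrow> ('a list \<Rightarrow> real) \<Rightarrow> 'a list \<Rightarrow> real" where
  "upper_laplacian X f = boundary X (coboundary X f)"

text \<open>\<open>cycles X d\<close> is \<open>Z\<^bsub>d-1\<^esub>\<close>, the kernel of \<open>\<partial>\<^bsub>d-1\<^esub>\<close> on \<open>\<Omega>\<^bsup>d-1\<^esup>\<close>.\<close>

definition cycles :: "'a set set \<Rightarrow> nat \<Rightarrow> ('a list \<Rightarrow> real) set" where
  "cycles X d = {f \<in> forms X d. boundary X f = (\<lambda>_. 0)}"

definition restricted_eigenvalues :: "'a set set \<Rightarrow> nat \<Rightarrow> real \<Rightarrow> real set" where
  "restricted_eigenvalues X d \<alpha> =
     {\<mu>. \<exists>f \<in> cycles X d. f \<noteq> (\<lambda>_. 0) \<and>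
          (\<lambda>\<sigma>. \<alpha> * f \<sigma> - upper_laplacian X f \<sigma>) = (\<lambda>\<sigma>. \<mu> * f \<sigma>)}"

text \<open>The operator \<open>\<alpha> I - \<Delta>\<^sup>+\<close> restricted to \<open>Z\<^bsub>d-1\<^esub>\<close> is self-adjoint, so its norm is the
  largest absolute value of its (real) eigenvalues.\<close>

definition rho :: "'a set set \<Rightarrow> nat \<Rightarrow> real \<Rightarrow> real" where
  "rho X d \<alpha> = Max (abs ` restricted_eigenvalues X d \<alpha>)"

definition crossing_cells :: "'a set set \<Rightarrow> nat \<Rightarrow> (nat \<Rightarrow> 'a set) \<Rightarrow> 'a set set" where
  "crossing_cells X d A = {\<sigma> \<in> cells X d. \<forall>i\<le>d. card (\<sigma> \<inter> A i) = 1}"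

end

theory Submission
  imports Defs "HOL-Analysis.Convex" "HOL-Analysis.Function_Topology"
begin

text \<open>Let \<open>\<phi>\<close> and \<open>\<psi>\<close> be the antisymmetrised indicator forms of the vertex blocks
  \<open>A\<^sub>0, \<dots>, A\<^bsub>d-1\<^esub>\<close> and \<open>A\<^sub>1, \<dots>, A\<^sub>d\<close>. They are orthogonal, \<open>\<langle>\<Delta>\<^sup>+ \<phi>, \<psi>\<rangle>\<close> is \<open>|F(A\<^sub>0, \<dots>, A\<^sub>d)|\<close> up to sign, and
  \<open>\<langle>\<partial>\<^sup>*\<partial> \<phi>, \<psi>\<rangle>\<close> is \<open>|A\<^sub>0| \<cdots> |A\<^sub>d|\<close> with the opposite sign. Because the skeleton is complete,
  \<open>\<partial>\<^sup>*\<partial> / n\<close> is the orthogonal projection onto the complement of the cycles, on which \<open>\<Delta>\<^sup>+\<close>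
  vanishes. Hence \<open>\<langle>(\<alpha> - \<Delta>\<^sup>+) P\<phi>, P\<psi>\<rangle>\<close>, where \<open>P\<close> projects onto the cycles, is the discrepancy up
  to sign; it is at most \<open>\<rho>\<^sub>\<alpha> \<parallel>\<phi>\<parallel> \<parallel>\<psi>\<parallel>\<close>, where \<open>\<parallel>\<phi>\<parallel> \<parallel>\<psi>\<parallel>\<close> is the geometric mean
  of \<open>|A\<^sub>0| \<cdots> |A\<^bsub>d-1\<^esub>|\<close> and \<open>|A\<^sub>1| \<cdots> |A\<^sub>d|\<close>. Ordering the blocks so that the two largest ones are \<open>A\<^sub>0\<close> and \<open>A\<^sub>d\<close> makes this
  at most \<open>\<rho>\<^sub>\<alpha> (|A\<^sub>0| \<cdots> |A\<^sub>d|)\<^bsup>d/(d+1)\<^esup>\<close>. Formally, inner products run over all orderings of the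
  cells, so on \<open>\<Omega>\<^bsup>d-1\<^esup>\<close> they are \<open>d!\<close> times those of the informal statement.\<close>

section \<open>Inner products over a finite index set and the norm of a symmetric operator\<close>

section \<open>Symmetric operators on finitely supported functions\<close>

definition dot :: "'b set \<Rightarrow> ('b \<Rightarrow> real) \<Rightarrow> ('b \<Rightarrow> real) \<Rightarrow> real" where
  "dot S f g = (\<Sum>x\<in>S. f x * g x)"

lemma dot_commute: "dot S f g = dot S g f"
  by (simp add: dot_def mult.commute)

lemma dot_add_left: "dot S (\<lambda>x. f x + g x) h = dot S f h + dot S g h"
  by (simp add: dot_def distrib_right sum.distrib)

lemma dot_scale_left: "dot S (\<lambda>x. c * f x) h = c * dot S f h"
  by (simp add: dot_def sum_distrib_left mult.assoc)

lemma dot_diff_left: "dot S (\<lambda>x. f x - g x) h = dot S f h - dot S g h"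
  by (simp add: dot_def left_diff_distrib sum_subtractf)

lemma dot_add_right: "dot S h (\<lambda>x. f x + g x) = dot S h f + dot S h g"
  by (simp add: dot_def distrib_left sum.distrib)

lemma dot_scale_right: "dot S h (\<lambda>x. c * f x) = c * dot S h f"
  by (simp add: dot_def sum_distrib_left mult.left_commute)

lemma dot_diff_right: "dot S h (\<lambda>x. f x - g x) = dot S h f - dot S h g"
  by (simp add: dot_def right_diff_distrib sum_subtractf)

lemma dot_zero [simp]: "dot S (\<lambda>_. 0) f = 0" "dot S f (\<lambda>_. 0) = 0"
  by (simp_all add: dot_def)

lemmas dot_linear = dot_add_left dot_scale_left dot_diff_left
  dot_add_right dot_scale_right dot_diff_right

lemma dot_self_nonneg: "0 \<le> dot S f f"
  by (simp add: dot_def sum_nonneg)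

lemma dot_self_eq_0:
  assumes "finite S" "dot S f f = 0" "\<And>x. x \<notin> S \<Longrightarrow> f x = 0"
  shows "f = (\<lambda>_. 0)"
proof
  fix x
  show "f x = 0"
    using assms by (cases "x \<in> S") (auto simp: dot_def sum_nonneg_eq_0_iff)
qed

lemma dot_Cauchy_Schwarz: "\<bar>dot S f g\<bar> \<le> sqrt (dot S f f) * sqrt (dot S g g)"
proof -
  have "(dot S f g)\<^sup>2 \<le> dot S f f * dot S g g"
    unfolding dot_def using Cauchy_Schwarz_ineq_sum[of f g S] by (simp add: power2_eq_square)
  then have "sqrt ((dot S f g)\<^sup>2) \<le> sqrt (dot S f f * dot S g g)"
    by (rule real_sqrt_le_mono)
  then show ?thesis by (simp add: real_sqrt_mult)
qed

lemma dot_normalise: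
  assumes "0 < dot S f f"
  defines "e \<equiv> \<lambda>x. inverse (sqrt (dot S f f)) * f x"
  shows "dot S e e = 1"
proof -
  have "dot S e e = inverse (sqrt (dot S f f) * sqrt (dot S f f)) * dot S f f"
    unfolding e_def dot_scale_left dot_scale_right
    by (simp only: inverse_mult_distrib mult.assoc)
  with assms(1) show ?thesis by simp
qed

text \<open>Bessel's inequality applied to each point mass bounds the size of an orthonormal family
  by the size of the support.\<close>
lemma card_orthonormal_le:
  assumes S: "finite S" and I: "finite I"
    and orth: "\<And>i j. i \<in> I \<Longrightarrow> j \<in> I \<Longrightarrow> dot S (e i) (e j) = (if i = j then 1 else 0)"
  shows "card I \<le> card S"
proof -
  have bessel: "(\<Sum>i\<in>I. (e i x)\<^sup>2) \<le> 1" if x: "x \<in> S" for x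
  proof -
    \<comment> \<open>Here \<open>m\<close> is the point mass at \<open>x\<close> and
      \<open>h\<close> its orthogonal projection onto the span of the family. Hence
      \<open>h x\<close> is at once the Bessel sum and the squared norm of \<open>h\<close>.\<close>
    define h where "h y = (\<Sum>i\<in>I. e i x * e i y)" for y
    define m where "m y = (if y = x then 1 else 0 :: real)" for y
    have mx: "dot S m f = f x" "dot S f m = f x" for f
      using S x by (auto simp: dot_def m_def if_distrib if_distribR cong: if_cong)
    have he: "dot S (e j) h = e j x" if j: "j \<in> I" for j
    proof -
      have "dot S (e j) h = (\<Sum>i\<in>I. e i x * dot S (e j) (e i))"
        unfolding dot_def h_def sum_distrib_left
        by (subst sum.swap) (simp add: mult.left_commute)
      also have "\<dots> = (\<Sum>i\<in>I. if i = j then e i x else 0)"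
        by (intro sum.cong) (auto simp: orth j)
      finally show ?thesis using I j by simp
    qed
    have hh: "dot S h h = h x"
    proof -
      have "dot S h h = (\<Sum>i\<in>I. e i x * dot S (e i) h)"
        unfolding dot_def sum_distrib_left
        by (subst sum.swap) (simp add: h_def sum_distrib_right mult.assoc)
      also have "\<dots> = h x"
        unfolding h_def by (intro sum.cong) (auto simp: he[unfolded h_def])
      finally show ?thesis .
    qed
    have "0 \<le> dot S (\<lambda>y. m y - h y) (\<lambda>y. m y - h y)"
      by (rule dot_self_nonneg)
    also have "\<dots> = 1 - h x"
      by (simp add: dot_linear mx hh) (simp add: m_def)
    finally show ?thesis by (simp add: h_def power2_eq_square)
  qed
  \<comment> \<open>The unit norms add up to \<open>card I\<close>; exchanging the sums leaves one
    Bessel sum, at most 1, for each point of \<open>S\<close>.\<close>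
  have "real (card I) = (\<Sum>i\<in>I. dot S (e i) (e i))"
    by (simp add: orth)
  also have "\<dots> = (\<Sum>x\<in>S. \<Sum>i\<in>I. (e i x)\<^sup>2)"
    unfolding dot_def by (subst sum.swap) (simp add: power2_eq_square)
  also have "\<dots> \<le> (\<Sum>x\<in>S. 1)"
    by (intro sum_mono bessel)
  finally show ?thesis by simp
qed

text \<open>A finite-dimensional inner product space is modelled without a basis, as a subspace
  \<open>Z\<close> of the functions vanishing off \<open>S\<close>. The topology is the product
  topology, so \<open>Z_closed\<close> and \<open>T_continuous\<close> are what a compactness
  argument on the unit sphere needs.\<close>

locale symmetric_operator =
  fixes S :: "'b set" and Z :: "('b \<Rightarrow> real) set" and T :: "('b \<Rightarrow> real) \<Rightarrow> 'b \<Rightarrow> real"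
  assumes finite_S: "finite S"
    and Z_add: "f \<in> Z \<Longrightarrow> g \<in> Z \<Longrightarrow> (\<lambda>x. f x + g x) \<in> Z"
    and Z_scale: "f \<in> Z \<Longrightarrow> (\<lambda>x. c * f x) \<in> Z"
    and Z_support: "f \<in> Z \<Longrightarrow> x \<notin> S \<Longrightarrow> f x = 0"
    and Z_closed: "closed Z"
    and T_Z: "f \<in> Z \<Longrightarrow> T f \<in> Z"
    and T_add: "T (\<lambda>x. f x + g x) = (\<lambda>x. T f x + T g x)"
    and T_scale: "T (\<lambda>x. c * f x) = (\<lambda>x. c * T f x)"
    and T_symmetric: "f \<in> Z \<Longrightarrow> g \<in> Z \<Longrightarrow> dot S (T f) g = dot S f (T g)"
    and T_continuous: "continuous_on UNIV (\<lambda>f. T f x)"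
begin

definition eigenvalues :: "real set" where
  "eigenvalues = {\<mu>. \<exists>f\<in>Z. f \<noteq> (\<lambda>_. 0) \<and> T f = (\<lambda>x. \<mu> * f x)}"

lemma dot_pos: "f \<in> Z \<Longrightarrow> f \<noteq> (\<lambda>_. 0) \<Longrightarrow> 0 < dot S f f"
  using dot_self_eq_0[OF finite_S, of f] Z_support[of f] dot_self_nonneg[of S f]
  by (metis order_le_less)

text \<open>Symmetry makes eigenvectors of distinct eigenvalues orthogonal, so there are at most
  \<open>card S\<close> eigenvalues. Finiteness gives \<open>Max\<close> over them its
  meaning.\<close>

lemma finite_eigenvalues: "finite eigenvalues"
proof (rule ccontr)
  assume "infinite eigenvalues"
  then obtain I where I: "I \<subseteq> eigenvalues" "finite I" "card I = Suc (card S)"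
    using infinite_arbitrarily_large by blast
  have "\<exists>f. f \<in> Z \<and> f \<noteq> (\<lambda>_. 0) \<and> T f = (\<lambda>x. \<mu> * f x)" if "\<mu> \<in> I" for \<mu>
    using that I by (auto simp: eigenvalues_def)
  then obtain f where f: "\<And>\<mu>. \<mu> \<in> I \<Longrightarrow> f \<mu> \<in> Z" "\<And>\<mu>. \<mu> \<in> I \<Longrightarrow> f \<mu> \<noteq> (\<lambda>_. 0)"
      "\<And>\<mu>. \<mu> \<in> I \<Longrightarrow> T (f \<mu>) = (\<lambda>x. \<mu> * f \<mu> x)"
    by metis
  define e where "e \<mu> = (\<lambda>x. inverse (sqrt (dot S (f \<mu>) (f \<mu>))) * f \<mu> x)" for \<mu>
  have "dot S (e i) (e j) = (if i = j then 1 else 0)" if ij: "i \<in> I" "j \<in> I" for i j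
  proof (cases "i = j")
    case True
    then show ?thesis
      using dot_normalise[OF dot_pos[OF f(1,2)]] ij(1) by (simp add: e_def)
  next
    case False
    have "i * dot S (f i) (f j) = j * dot S (f i) (f j)"
      using T_symmetric[OF f(1)[OF ij(1)] f(1)[OF ij(2)]] f(3) ij by (simp add: dot_linear)
    with False show ?thesis by (simp add: e_def dot_linear)
  qed
  from card_orthonormal_le[OF finite_S I(2) this] I(3) show False by simp
qed

lemma continuous_on_dot_T: "continuous_on UNIV (\<lambda>f. dot S (T f) (T f))"
  unfolding dot_def by (intro continuous_intros T_continuous)

text \<open>The sphere is a closed part of a product of compact sets: \<open>{-1..1}\<close> at the
  points of \<open>S\<close> and \<open>{0}\<close> elsewhere. Tychonoff's theorem applies to this
  product.\<close>

lemma compact_unit_sphere: "compact {f \<in> Z. dot S f f = 1}"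
proof -
  define K where "K = PiE UNIV (\<lambda>x. if x \<in> S then {-1..1::real} else {0})"
  have "compactin (product_topology (\<lambda>_. euclidean) UNIV) K"
    unfolding K_def compactin_PiE by auto
  then have "compact K"
    by (simp add: euclidean_product_topology)
  moreover have "closed {f \<in> Z. dot S f f = 1}"
  proof -
    have "closed {f. dot S f f = 1}"
      unfolding dot_def
      by (intro closed_Collect_eq continuous_intros continuous_on_product_coordinates)
    with Z_closed have "closed (Z \<inter> {f. dot S f f = 1})" by (rule closed_Int)
    then show ?thesis by (simp add: Collect_conj_eq)
  qed
  moreover have "{f \<in> Z. dot S f f = 1} \<subseteq> K"
  proof
    fix f assume f: "f \<in> {f \<in> Z. dot S f f = 1}"
    have "\<bar>f x\<bar> \<le> 1" if "x \<in> S" for x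
    proof -
      have "f x * f x \<le> dot S f f"
        unfolding dot_def by (rule member_le_sum) (use that finite_S in auto)
      with f show ?thesis by (simp add: power2_eq_square flip: abs_square_le_1)
    qed
    with f Z_support show "f \<in> K"
      by (auto simp: K_def abs_le_iff minus_le_iff)
  qed
  ultimately show ?thesis
    by (metis (lifting) compact_Int_closed inf.absorb_iff2)
qed

text \<open>A maximiser \<open>f\<close> of \<open>\<langle>T f, T f\<rangle>\<close> on the unit sphere satisfies \<open>T\<^sup>2 f = m\<^sup>2 f\<close>, and
  \<open>T\<^sup>2 - m\<^sup>2 = (T - m) (T + m)\<close>.\<close>
lemma norm_attained:
  assumes "f0 \<in> Z" "f0 \<noteq> (\<lambda>_. 0)"
  obtains m where "m \<in> abs ` eigenvalues" "0 \<le> m"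
    "\<And>f. f \<in> Z \<Longrightarrow> dot S (T f) (T f) \<le> m\<^sup>2 * dot S f f"
proof -
  define q where "q f = dot S (T f) (T f)" for f
  have normalised: "(\<lambda>x. inverse (sqrt (dot S f f)) * f x) \<in> {f \<in> Z. dot S f f = 1}"
    if "f \<in> Z" "f \<noteq> (\<lambda>_. 0)" for f
    using dot_normalise[OF dot_pos[OF that]] Z_scale[OF that(1)] by simp
  then have "{f \<in> Z. dot S f f = 1} \<noteq> {}"
    using assms by blast
  from continuous_attains_sup[OF compact_unit_sphere this
      continuous_on_subset[OF continuous_on_dot_T subset_UNIV]]
  obtain u where u: "u \<in> Z" "dot S u u = 1"
    and max: "\<And>f. f \<in> Z \<Longrightarrow> dot S f f = 1 \<Longrightarrow> q f \<le> q u"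
    unfolding q_def by auto
  have le: "q f \<le> q u * dot S f f" if "f \<in> Z" for f
  proof (cases "f = (\<lambda>_. 0)")
    case True
    then have "T f = (\<lambda>x. 0)" using T_scale[of 0 "\<lambda>_. 0"] by simp
    with True show ?thesis by (simp add: q_def)
  next
    case False
    have "q (\<lambda>x. inverse (sqrt (dot S f f)) * f x) \<le> q u"
      using normalised[OF that False] max by auto
    then have "inverse (dot S f f) * q f \<le> q u"
      using dot_pos[OF that False]
      by (simp add: q_def T_scale dot_scale_left dot_scale_right mult.assoc[symmetric]
          flip: inverse_mult_distrib)
    then show ?thesis
      using dot_pos[OF that False] by (simp add: field_simps)
  qed
  define m where "m = sqrt (q u)"
  have m: "0 \<le> m" "m\<^sup>2 = q u"
    by (simp_all add: m_def q_def dot_self_nonneg)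
  \<comment> \<open>The defect in the equation \<open>T (T u) = q u * u\<close>; moving
    \<open>u\<close> in this direction tests first-order optimality.\<close>
  define h where "h = (\<lambda>x. T (T u) x + (- q u) * u x)"
  have h: "h \<in> Z" unfolding h_def by (intro Z_add Z_scale T_Z u)
  define b c where "b = dot S h h" and "c = q u * dot S h h - q h"
  \<comment> \<open>This is \<open>le\<close> at \<open>u + t * h\<close>. The constant terms
    cancel, and symmetry of \<open>T\<close> turns the linear coefficient into
    \<open>- 2 * b\<close>, where \<open>b\<close> is the squared norm of the defect.\<close>
  have perturb: "0 \<le> - 2 * t * b + t\<^sup>2 * c" for t
  proof -
    have "(\<lambda>x. u x + t * h x) \<in> Z" by (intro Z_add Z_scale u h)
    from le[OF this]
    have "q u + 2 * t * dot S (T u) (T h) + t\<^sup>2 * q h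
        \<le> q u * (1 + 2 * t * dot S u h + t\<^sup>2 * dot S h h)"
      by (simp add: q_def T_add T_scale dot_linear u power2_eq_square dot_commute[of S h u]
          dot_commute[of S "T h" "T u"] algebra_simps)
    moreover have "dot S (T u) (T h) = b + q u * dot S u h"
    proof -
      have "b = dot S (T (T u)) h - q u * dot S u h"
        unfolding b_def by (subst (1) h_def) (simp add: dot_linear)
      then show ?thesis using T_symmetric[OF T_Z[OF u(1)] h] by simp
    qed
    ultimately show ?thesis by (simp add: c_def algebra_simps)
  qed
  have c: "0 \<le> c" using le[OF h] by (simp add: c_def)
  have "b = 0"
  proof (rule ccontr)
    assume "b \<noteq> 0"
    \<comment> \<open>With this \<open>t\<close> the right-hand side of \<open>perturb\<close>
      becomes \<open>- (t\<^sup>2 * (c + 2))\<close>, which is negative. Adding 1 keeps the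
      denominator positive when \<open>c\<close> is 0.\<close>
    define t where "t = b / (c + 1)"
    have "b = t * (c + 1)" "t \<noteq> 0"
      using c \<open>b \<noteq> 0\<close> by (simp_all add: t_def)
    then have "0 \<le> - (t\<^sup>2 * (c + 2))"
      using perturb[of t] by (simp add: power2_eq_square algebra_simps)
    moreover have "0 < t\<^sup>2 * (c + 2)"
      using c \<open>t \<noteq> 0\<close> by simp
    ultimately show False by simp
  qed
  then have "h x = 0" for x
    using dot_pos[OF h] by (auto simp: b_def)
  then have TT: "T (T u) x = m\<^sup>2 * u x" for x
    by (simp add: h_def m(2))
  have u0: "u \<noteq> (\<lambda>_. 0)" using u(2) by auto
  \<comment> \<open>Since \<open>(T - m) g = (T\<^sup>2 - m\<^sup>2) u = 0\<close>, the vector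
    \<open>g\<close> is an eigenvector for \<open>m\<close> unless it vanishes, and then
    \<open>u\<close> is one for \<open>- m\<close>.\<close>
  define g where "g = (\<lambda>x. T u x + m * u x)"
  have g: "g \<in> Z" unfolding g_def by (intro Z_add Z_scale T_Z u)
  have "m \<in> abs ` eigenvalues"
  proof (cases "g = (\<lambda>_. 0)")
    case True
    then have "g x = 0" for x by simp
    then have "T u x = (- m) * u x" for x
      by (simp add: g_def eq_neg_iff_add_eq_0)
    then have "T u = (\<lambda>x. (- m) * u x)" by blast
    then have "- m \<in> eigenvalues" using u u0 by (auto simp: eigenvalues_def)
    with m(1) show ?thesis by force
  next
    case False
    have "T g = (\<lambda>x. m * g x)"
      by (simp add: g_def T_add T_scale TT power2_eq_square algebra_simps)
    then have "m \<in> eigenvalues" using g False by (auto simp: eigenvalues_def)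
    with m(1) show ?thesis by force
  qed
  with that[OF this m(1)] le m show thesis by (simp add: q_def)
qed

text \<open>Cauchy-Schwarz reduces the bilinear bound to \<open>norm_attained\<close>. The nonzero
  \<open>f0\<close> ensures that there is an eigenvalue to take the maximum over.\<close>

lemma abs_dot_le_Max_eigenvalue:
  assumes "f0 \<in> Z" "f0 \<noteq> (\<lambda>_. 0)" and "f \<in> Z" "g \<in> Z"
  shows "\<bar>dot S (T f) g\<bar> \<le> Max (abs ` eigenvalues) * sqrt (dot S f f) * sqrt (dot S g g)"
    and "0 \<le> Max (abs ` eigenvalues)"
proof -
  obtain m where m: "m \<in> abs ` eigenvalues" "0 \<le> m"
    "\<And>f. f \<in> Z \<Longrightarrow> dot S (T f) (T f) \<le> m\<^sup>2 * dot S f f"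
    using norm_attained[OF assms(1,2)] by blast
  have mM: "m \<le> Max (abs ` eigenvalues)"
    using finite_eigenvalues m(1) by simp
  then show "0 \<le> Max (abs ` eigenvalues)" using m(2) by simp
  have "\<bar>dot S (T f) g\<bar> \<le> sqrt (dot S (T f) (T f)) * sqrt (dot S g g)"
    by (rule dot_Cauchy_Schwarz)
  also have "\<dots> \<le> sqrt (m\<^sup>2 * dot S f f) * sqrt (dot S g g)"
    by (intro mult_right_mono real_sqrt_le_mono m(3) assms) (simp add: dot_self_nonneg)
  also have "\<dots> = m * (sqrt (dot S f f) * sqrt (dot S g g))"
    using m(2) by (simp add: real_sqrt_mult)
  also have "\<dots> \<le> Max (abs ` eigenvalues) * (sqrt (dot S f f) * sqrt (dot S g g))"
    by (intro mult_right_mono mM) (simp add: dot_self_nonneg)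
  finally show "\<bar>dot S (T f) g\<bar> \<le> Max (abs ` eigenvalues) * sqrt (dot S f f) * sqrt (dot S g g)"
    by (simp add: mult.assoc)
qed

end

section \<open>Alternating functions on lists and the spaces of forms\<close>

section \<open>Forms, boundary and coboundary\<close>

text \<open>Only adjacent swaps are mentioned, and neither cells nor lengths. The notion therefore
  survives fixing a prefix, which is what inductions over lists require; \<open>forms_iff\<close>
  relates it to the sign rule for all permutations.\<close>

definition alternating :: "('a list \<Rightarrow> real) \<Rightarrow> bool" where
  "alternating f \<longleftrightarrow> (\<forall>xs u v ys. f (xs @ u # v # ys) = - f (xs @ v # u # ys))"

lemma alternatingD: "alternating f \<Longrightarrow> f (xs @ u # v # ys) = - f (xs @ v # u # ys)"
  unfolding alternating_def by blast

lemma alternating_append: "alternating f \<Longrightarrow> alternating (\<lambda>l. f (xs @ l))"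
  unfolding alternating_def by (metis append_assoc)

lemma alternating_Cons: "alternating f \<Longrightarrow> alternating (\<lambda>l. f (x # l))"
  using alternating_append[of f "[x]"] by simp

lemma alternating_Cons_Cons: "alternating f \<Longrightarrow> f (u # v # l) = - f (v # u # l)"
  using alternatingD[of f "[]" u v l] by simp

lemma alternating_move_to_front:
  "alternating f \<Longrightarrow> f (xs @ u # ys) = (- 1) ^ length xs * f (u # xs @ ys)"
proof (induction xs arbitrary: f)
  case (Cons x xs)
  have "f (x # xs @ u # ys) = (- 1) ^ length xs * f (x # u # xs @ ys)"
    by (rule Cons.IH[OF alternating_Cons[OF Cons.prems]])
  also have "f (x # u # xs @ ys) = - f (u # x # xs @ ys)"
    by (rule alternating_Cons_Cons[OF Cons.prems])
  finally show ?case by simp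
qed simp

text \<open>On both sides the later entry is pulled across \<open>ys\<close> at the same cost in
  sign, so that a single adjacent swap remains.\<close>

lemma alternating_exchange:
  assumes "alternating f"
  shows "f (xs @ u # ys @ v # zs) = - f (xs @ v # ys @ u # zs)"
proof -
  define g where "g l = f (xs @ l)" for l
  have g: "alternating g" unfolding g_def by (rule alternating_append[OF assms])
  have move: "g (a # ys @ b # zs) = (- 1) ^ length ys * g (a # b # ys @ zs)" for a b
    using alternating_move_to_front[OF alternating_Cons[OF g, of a], of ys b zs] by simp
  have "g (u # ys @ v # zs) = - g (v # ys @ u # zs)"
    unfolding move by (subst alternating_Cons_Cons[OF g]) simp
  then show ?thesis by (simp add: g_def)
qed

lemma permute_list_transpose:
  "permute_list (transpose (length xs) (Suc (length xs + length ys))) (xs @ u # ys @ v # zs)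
     = xs @ v # ys @ u # zs"
proof (rule nth_equalityI)
  fix i
  let ?p = "transpose (length xs) (Suc (length xs + length ys))"
  assume i: "i < length (permute_list ?p (xs @ u # ys @ v # zs))"
  have "?p permutes {..<length (xs @ u # ys @ v # zs)}"
    by (rule permutes_swap_id) auto
  with i show "permute_list ?p (xs @ u # ys @ v # zs) ! i = (xs @ v # ys @ u # zs) ! i"
    by (auto simp: permute_list_nth transpose_def nth_append nth_Cons')
qed simp

lemma alternating_permute_list_transpose:
  assumes f: "alternating f" and ij: "i < j" "j < length l"
  shows "f (permute_list (transpose i j) l) = - f l"
proof -
  define xs ys zs where "xs = take i l" "ys = take (j - Suc i) (drop (Suc i) l)"
    "zs = drop (Suc j) l"
  have "drop (Suc i) l = ys @ l ! j # zs"
    using id_take_nth_drop[of "j - Suc i" "drop (Suc i) l"] ij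
    by (simp add: xs_ys_zs_def)
  then have l: "l = xs @ l ! i # ys @ l ! j # zs"
    using id_take_nth_drop[of i l] ij by (simp add: xs_ys_zs_def)
  have len: "i = length xs" "j = Suc (length xs + length ys)"
    using ij by (auto simp: xs_ys_zs_def)
  have "permute_list (transpose i j) l = xs @ l ! j # ys @ l ! i # zs"
    by (subst l, unfold len, rule permute_list_transpose)
  then have "f (permute_list (transpose i j) l) = - f (xs @ l ! i # ys @ l ! j # zs)"
    using alternating_exchange[OF f] by metis
  also have "xs @ l ! i # ys @ l ! j # zs = l" by (rule l[symmetric])
  finally show ?thesis .
qed

lemma alternating_permute_list:
  assumes f: "alternating f" and p: "p permutes {..<length l}"
  shows "f (permute_list p l) = of_int (sign p) * f l"
proof -
  \<comment> \<open>The list is generalised because permuting by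
    \<open>transpose a b \<circ> p\<close> applies \<open>p\<close> to the list that has already
    been transposed.\<close>
  have "\<forall>l'. length l' = length l \<longrightarrow> f (permute_list p l') = of_int (sign p) * f l'"
    using p finite_lessThan
  proof (induction p rule: permutes_induct)
    case id
    then show ?case by simp
  next
    case (swap a b p)
    show ?case
    proof (intro allI impI)
      fix l' :: "'a list" assume l': "length l' = length l"
      have "f (permute_list (transpose a b) l') = - f l'"
      proof (cases "a < b")
        case True
        then show ?thesis using alternating_permute_list_transpose[OF f] swap l' by simp
      next
        case False
        then show ?thesis
          using alternating_permute_list_transpose[OF f, of b a l'] swap l'
          by (simp add: transpose_commute)
      qed
      moreover have "permutation p"
        using \<open>p permutes {..<length l}\<close> finite_lessThan by (auto simp: permutation_permutes)
      ultimately show "f (permute_list (transpose a b \<circ> p) l')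
          = of_int (sign (transpose a b \<circ> p)) * f l'"
        using swap l'
        by (simp add: permute_list_compose sign_compose permutation_swap_id sign_swap_id)
    qed
  qed
  then show ?thesis by simp
qed

lemma ordered_cells_permute_list:
  assumes "p permutes {..<k}" "\<sigma> \<in> ordered_cells X k"
  shows "permute_list p \<sigma> \<in> ordered_cells X k"
  using assms by (auto simp: ordered_cells_def)

text \<open>Adjacent transpositions generate all permutations, and they preserve
  \<open>ordered_cells X k\<close> as well as its complement, where both sides of the swap rule are
  0.\<close>

lemma forms_iff:
  "f \<in> forms X k \<longleftrightarrow> (\<forall>\<sigma>. \<sigma> \<notin> ordered_cells X k \<longrightarrow> f \<sigma> = 0) \<and> alternating f"
proof
  assume f: "f \<in> forms X k"
  have "f (xs @ u # v # ys) = - f (xs @ v # u # ys)" for xs u v ys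
  proof (cases "xs @ v # u # ys \<in> ordered_cells X k")
    case True
    let ?p = "transpose (length xs) (Suc (length xs))"
    have "k = length (xs @ v # u # ys)" using True by (simp add: ordered_cells_def)
    then have "?p permutes {..<k}" by (intro permutes_swap_id) auto
    moreover have "\<not> evenperm ?p" by (simp add: evenperm_swap)
    moreover have "permute_list ?p (xs @ v # u # ys) = xs @ u # v # ys"
      using permute_list_transpose[of xs "[]"] by simp
    ultimately show ?thesis using f True unfolding forms_def by fastforce
  next
    case False
    then have "xs @ u # v # ys \<notin> ordered_cells X k"
      by (auto simp: ordered_cells_def insert_commute)
    with False f show ?thesis by (simp add: forms_def)
  qed
  with f show "(\<forall>\<sigma>. \<sigma> \<notin> ordered_cells X k \<longrightarrow> f \<sigma> = 0) \<and> alternating f"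
    unfolding forms_def alternating_def by blast
next
  assume f: "(\<forall>\<sigma>. \<sigma> \<notin> ordered_cells X k \<longrightarrow> f \<sigma> = 0) \<and> alternating f"
  have "f (permute_list p \<sigma>) = (if evenperm p then f \<sigma> else - f \<sigma>)"
    if "\<sigma> \<in> ordered_cells X k" "p permutes {..<k}" for p \<sigma>
    using alternating_permute_list[of f p \<sigma>] f that by (simp add: ordered_cells_def sign_def)
  with f show "f \<in> forms X k" by (simp add: forms_def)
qed

lemma forms_alternating: "f \<in> forms X k \<Longrightarrow> alternating f"
  by (simp add: forms_iff)

lemma forms_support: "f \<in> forms X k \<Longrightarrow> \<sigma> \<notin> ordered_cells X k \<Longrightarrow> f \<sigma> = 0"
  by (simp add: forms_iff)

lemma forms_not_distinct: "f \<in> forms X k \<Longrightarrow> \<not> distinct \<sigma> \<Longrightarrow> f \<sigma> = 0"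
  by (erule forms_support) (simp add: ordered_cells_def)

lemma alternating_linear:
  assumes f: "alternating f" and g: "alternating g"
  shows "alternating (\<lambda>\<sigma>. a * f \<sigma> + b * g \<sigma>)"
  unfolding alternating_def
proof (intro allI)
  fix xs ys :: "'a list" and u v
  show "a * f (xs @ u # v # ys) + b * g (xs @ u # v # ys)
      = - (a * f (xs @ v # u # ys) + b * g (xs @ v # u # ys))"
    using alternatingD[OF f, of xs u v ys] alternatingD[OF g, of xs u v ys] by simp
qed

lemma forms_linear:
  assumes "f \<in> forms X k" "g \<in> forms X k"
  shows "(\<lambda>\<sigma>. a * f \<sigma> + b * g \<sigma>) \<in> forms X k"
  using assms alternating_linear[of f g a b] unfolding forms_iff by simp

lemma forms_add: "f \<in> forms X k \<Longrightarrow> g \<in> forms X k \<Longrightarrow> (\<lambda>\<sigma>. f \<sigma> + g \<sigma>) \<in> forms X k"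
  using forms_linear[of f X k g 1 1] by simp

lemma forms_diff: "f \<in> forms X k \<Longrightarrow> g \<in> forms X k \<Longrightarrow> (\<lambda>\<sigma>. f \<sigma> - g \<sigma>) \<in> forms X k"
  using forms_linear[of f X k g 1 "- 1"] by simp

lemma forms_scale: "f \<in> forms X k \<Longrightarrow> (\<lambda>\<sigma>. c * f \<sigma>) \<in> forms X k"
  using forms_linear[of f X k f c 0] by simp

text \<open>Forms are cut out by equations between finitely many coordinates each, and such
  equations are closed in the product topology.\<close>

lemma closed_forms: "closed (forms X k)"
proof -
  have "forms X k = (\<Inter>\<sigma>\<in>- ordered_cells X k. {f. f \<sigma> = 0}) \<inter>
      (\<Inter>xs. \<Inter>u. \<Inter>v. \<Inter>ys. {f. f (xs @ u # v # ys) = - f (xs @ v # u # ys)})"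
    unfolding set_eq_iff forms_iff alternating_def by blast
  moreover have "closed \<dots>"
    by (intro closed_Int closed_INT ballI closed_Collect_eq continuous_intros
        continuous_on_product_coordinates)
  ultimately show ?thesis by simp
qed

text \<open>This is the sum in \<open>coboundary\<close> freed from the test for cells, so that the
  recursion \<open>alternating_sum_Cons\<close> holds on every list.\<close>

definition alternating_sum :: "('a list \<Rightarrow> real) \<Rightarrow> 'a list \<Rightarrow> real" where
  "alternating_sum f l = (\<Sum>i<length l. (- 1) ^ i * f (take i l @ drop (Suc i) l))"

lemma alternating_sum_Nil [simp]: "alternating_sum f [] = 0"
  by (simp add: alternating_sum_def)

lemma alternating_sum_Cons [simp]:
  "alternating_sum f (x # l) = f l - alternating_sum (\<lambda>l. f (x # l)) l"
  by (simp add: alternating_sum_def sum.lessThan_Suc_shift sum_negf del: sum.lessThan_Suc)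

lemma alternating_sum_uminus: "alternating_sum (\<lambda>l. - f l) l = - alternating_sum f l"
  by (simp add: alternating_sum_def sum_negf)

text \<open>By the recursion, the terms that delete \<open>u\<close> or \<open>v\<close> trade
  places with opposite signs, and every other term still contains the swapped pair.\<close>

lemma alternating_alternating_sum: "alternating f \<Longrightarrow> alternating (alternating_sum f)"
proof -
  assume "alternating f"
  then have "alternating_sum f (xs @ u # v # ys) = - alternating_sum f (xs @ v # u # ys)"
    for xs u v ys
  proof (induction xs arbitrary: f)
    case Nil
    have "(\<lambda>l. f (u # v # l)) = (\<lambda>l. - f (v # u # l))"
      using alternating_Cons_Cons[OF Nil] by blast
    then show ?case by (simp add: alternating_sum_uminus)
  next
    case (Cons x xs)
    show ?case
      using alternatingD[OF Cons.prems, of xs u v ys] Cons.IH[OF alternating_Cons[OF Cons.prems, of x]]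
      by simp
  qed
  then show ?thesis unfolding alternating_def by blast
qed

text \<open>Only deleting the last entry removes \<open>w\<close>, so one term survives. Later
  \<open>w\<close> is a vertex of the last block, which the block form of the first blocks does not
  meet.\<close>

lemma alternating_sum_snoc:
  assumes "\<And>l. w \<in> set l \<Longrightarrow> f l = 0"
  shows "alternating_sum f (\<tau> @ [w]) = (- 1) ^ length \<tau> * f \<tau>"
  using assms by (simp add: alternating_sum_def)

lemma coboundary_eq:
  "coboundary X f \<sigma> = (if distinct \<sigma> \<and> set \<sigma> \<in> X then alternating_sum f \<sigma> else 0)"
  by (simp add: coboundary_def alternating_sum_def)

lemma coboundary_add: "coboundary X (\<lambda>\<sigma>. f \<sigma> + g \<sigma>) = (\<lambda>\<sigma>. coboundary X f \<sigma> + coboundary X g \<sigma>)"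
  by (auto simp: coboundary_def distrib_left sum.distrib)

lemma coboundary_scale: "coboundary X (\<lambda>\<sigma>. c * f \<sigma>) = (\<lambda>\<sigma>. c * coboundary X f \<sigma>)"
  by (auto simp: coboundary_def sum_distrib_left mult.left_commute)

lemma coboundary_diff: "coboundary X (\<lambda>\<sigma>. f \<sigma> - g \<sigma>) = (\<lambda>\<sigma>. coboundary X f \<sigma> - coboundary X g \<sigma>)"
  by (auto simp: coboundary_def right_diff_distrib sum_subtractf)

lemma boundary_add: "boundary X (\<lambda>\<sigma>. f \<sigma> + g \<sigma>) = (\<lambda>\<sigma>. boundary X f \<sigma> + boundary X g \<sigma>)"
  by (auto simp: boundary_def sum.distrib)

lemma boundary_scale: "boundary X (\<lambda>\<sigma>. c * f \<sigma>) = (\<lambda>\<sigma>. c * boundary X f \<sigma>)"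
  by (auto simp: boundary_def sum_distrib_left)

lemma boundary_diff: "boundary X (\<lambda>\<sigma>. f \<sigma> - g \<sigma>) = (\<lambda>\<sigma>. boundary X f \<sigma> - boundary X g \<sigma>)"
  by (auto simp: boundary_def sum_subtractf)

lemma continuous_on_boundary: "continuous_on UNIV (\<lambda>f. boundary X f \<sigma>)"
  unfolding boundary_def by (intro continuous_intros continuous_on_product_coordinates)

lemma continuous_on_upper_laplacian: "continuous_on UNIV (\<lambda>f. upper_laplacian X f \<sigma>)"
proof -
  have "continuous_on UNIV (\<lambda>f. coboundary X f \<tau>)" for \<tau>
    unfolding coboundary_def
    by (cases "distinct \<tau> \<and> set \<tau> \<in> X")
      (auto intro!: continuous_intros continuous_on_product_coordinates)
  then show ?thesis
    unfolding upper_laplacian_def boundary_def by (intro continuous_intros)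
qed

lemma coboundary_forms:
  assumes f: "f \<in> forms X k"
  shows "coboundary X f \<in> forms X (Suc k)"
  unfolding forms_iff
proof (intro conjI allI impI)
  fix \<sigma> assume \<sigma>: "\<sigma> \<notin> ordered_cells X (Suc k)"
  show "coboundary X f \<sigma> = 0"
  proof (cases "distinct \<sigma> \<and> set \<sigma> \<in> X")
    case True
    with \<sigma> have len: "length \<sigma> \<noteq> Suc k" by (simp add: ordered_cells_def)
    have "f (take i \<sigma> @ drop (Suc i) \<sigma>) = 0" if "i < length \<sigma>" for i
      by (rule forms_support[OF f]) (use that len in \<open>auto simp: ordered_cells_def\<close>)
    then show ?thesis by (simp add: coboundary_def)
  qed (auto simp: coboundary_eq)
next
  show "alternating (coboundary X f)"
    unfolding alternating_def
  proof (intro allI)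
    fix xs ys :: "'a list" and u v
    have "distinct (xs @ u # v # ys) = distinct (xs @ v # u # ys)"
      "set (xs @ u # v # ys) = set (xs @ v # u # ys)" by auto
    then show "coboundary X f (xs @ u # v # ys) = - coboundary X f (xs @ v # u # ys)"
      unfolding coboundary_eq
      using alternatingD[OF alternating_alternating_sum[OF forms_alternating[OF f]], of xs u v ys]
      by simp
  qed
qed

text \<open>Renaming the two summation variables shows that the sum is its own negative.\<close>

lemma sum_sum_alternating:
  assumes "alternating f"
  shows "(\<Sum>v\<in>V. \<Sum>w\<in>V. f (w # v # \<sigma>)) = 0"
proof -
  have "(\<Sum>v\<in>V. \<Sum>w\<in>V. f (w # v # \<sigma>)) = (\<Sum>v\<in>V. \<Sum>w\<in>V. f (v # w # \<sigma>))"
    by (rule sum.swap)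
  also have "\<dots> = - (\<Sum>v\<in>V. \<Sum>w\<in>V. f (w # v # \<sigma>))"
    unfolding sum_negf[symmetric]
    by (intro sum.cong refl) (rule alternating_Cons_Cons[OF assms])
  finally show ?thesis by simp
qed

section \<open>Boundary, coboundary and upper Laplacian of a finite complex\<close>

locale vertex_complex =
  fixes V :: "'a set" and X :: "'a set set"
  assumes complex: "simplicial_complex V X"
begin

lemma finite_V: "finite V"
  using complex by (simp add: simplicial_complex_def)

lemma cell_subset: "\<sigma> \<in> X \<Longrightarrow> \<sigma> \<subseteq> V"
  using complex by (auto simp: simplicial_complex_def)

lemma subcell: "\<sigma> \<in> X \<Longrightarrow> \<tau> \<subseteq> \<sigma> \<Longrightarrow> \<tau> \<in> X"
  using complex by (auto simp: simplicial_complex_def)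

lemma finite_ordered_cells: "finite (ordered_cells X k)"
  by (rule finite_subset[OF _ finite_lists_length_eq[OF finite_V, of k]])
    (auto simp: ordered_cells_def dest: cell_subset)

lemma ordered_cells_ConsD:
  "v # \<sigma> \<in> ordered_cells X (Suc k) \<Longrightarrow> v \<in> V \<and> \<sigma> \<in> ordered_cells X k"
  using cell_subset subcell by (fastforce simp: ordered_cells_def)

text \<open>The added terms vanish because forms are zero off the ordered cells. A range of
  summation that does not depend on \<open>\<sigma>\<close> lets sums be exchanged.\<close>

lemma boundary_eq:
  assumes "f \<in> forms X (Suc k)"
  shows "boundary X f \<sigma> = (\<Sum>v\<in>V. f (v # \<sigma>))"
  unfolding boundary_def
proof (rule sum.mono_neutral_left[OF finite_V])
  show "{v. v \<notin> set \<sigma> \<and> insert v (set \<sigma>) \<in> X} \<subseteq> V"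
    using cell_subset by auto
  show "\<forall>v\<in>V - {v. v \<notin> set \<sigma> \<and> insert v (set \<sigma>) \<in> X}. f (v # \<sigma>) = 0"
  proof
    fix v assume "v \<in> V - {v. v \<notin> set \<sigma> \<and> insert v (set \<sigma>) \<in> X}"
    then show "f (v # \<sigma>) = 0"
      by (intro forms_support[OF assms]) (auto simp: ordered_cells_def)
  qed
qed

lemma boundary_forms:
  assumes f: "f \<in> forms X (Suc k)"
  shows "boundary X f \<in> forms X k"
  unfolding forms_iff
proof (intro conjI allI impI)
  fix \<sigma> assume "\<sigma> \<notin> ordered_cells X k"
  then have "f (v # \<sigma>) = 0" for v
    using ordered_cells_ConsD forms_support[OF f] by blast
  then show "boundary X f \<sigma> = 0" by (simp add: boundary_def)
next
  show "alternating (boundary X f)"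
    unfolding alternating_def boundary_eq[OF f] sum_negf[symmetric]
    using alternatingD[OF alternating_Cons[OF forms_alternating[OF f]]]
    by (intro allI sum.cong refl) blast
qed

lemma sum_boundary:
  assumes "f \<in> forms X (Suc k)"
  shows "(\<Sum>v\<in>V. boundary X f (v # \<sigma>)) = 0"
  unfolding boundary_eq[OF assms] by (rule sum_sum_alternating[OF forms_alternating[OF assms]])

lemma boundary_boundary: "f \<in> forms X (Suc (Suc k)) \<Longrightarrow> boundary X (boundary X f) = (\<lambda>_. 0)"
  using boundary_eq[OF boundary_forms] sum_boundary by fastforce

text \<open>Inner products over orderings count a cell with \<open>k\<close> vertices
  \<open>fact k\<close> times, which explains the factor \<open>Suc k\<close>. In the proof it is
  the number of positions at which a vertex may be deleted; each contributes equally once that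
  vertex is moved to the front.\<close>

lemma coboundary_adjoint:
  assumes f: "f \<in> forms X k" and g: "g \<in> forms X (Suc k)"
  shows "dot (ordered_cells X (Suc k)) (coboundary X f) g
    = real (Suc k) * dot (ordered_cells X k) f (boundary X g)"
proof -
  let ?L = "ordered_cells X (Suc k)"
  have front: "(- 1) ^ i * f (take i \<sigma> @ drop (Suc i) \<sigma>) * g \<sigma>
      = f (take i \<sigma> @ drop (Suc i) \<sigma>) * g (\<sigma> ! i # take i \<sigma> @ drop (Suc i) \<sigma>)"
    if "i < Suc k" "\<sigma> \<in> ?L" for i \<sigma>
  proof -
    have "length \<sigma> = Suc k" using that by (simp add: ordered_cells_def)
    then have "g \<sigma> = (- 1) ^ i * g (\<sigma> ! i # take i \<sigma> @ drop (Suc i) \<sigma>)"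
      using alternating_move_to_front[OF forms_alternating[OF g],
          of "take i \<sigma>" "\<sigma> ! i" "drop (Suc i) \<sigma>"] id_take_nth_drop[of i \<sigma>] that(1)
      by simp
    then have "(- 1) ^ i * g \<sigma> = g (\<sigma> ! i # take i \<sigma> @ drop (Suc i) \<sigma>)"
      by (simp add: mult.assoc[symmetric] power_mult_distrib[symmetric])
    then show ?thesis by (simp add: mult.commute mult.left_commute)
  qed
  have rotate: "(\<Sum>\<sigma>\<in>?L. f (take i \<sigma> @ drop (Suc i) \<sigma>) * g (\<sigma> ! i # take i \<sigma> @ drop (Suc i) \<sigma>))
      = (\<Sum>\<tau>\<in>?L. f (tl \<tau>) * g \<tau>)" if i: "i < Suc k" for i
  proof (rule sum.reindex_bij_witness[where
        i = "\<lambda>\<tau>. take i (tl \<tau>) @ hd \<tau> # drop i (tl \<tau>)" and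
        j = "\<lambda>\<sigma>. \<sigma> ! i # take i \<sigma> @ drop (Suc i) \<sigma>"])
    fix \<sigma> assume \<sigma>: "\<sigma> \<in> ?L"
    then have len: "length \<sigma> = Suc k" by (simp add: ordered_cells_def)
    have eq: "take i \<sigma> @ \<sigma> ! i # drop (Suc i) \<sigma> = \<sigma>"
      using id_take_nth_drop[of i \<sigma>] i len by simp
    then show "take i (tl (\<sigma> ! i # take i \<sigma> @ drop (Suc i) \<sigma>)) @
        hd (\<sigma> ! i # take i \<sigma> @ drop (Suc i) \<sigma>) # drop i (tl (\<sigma> ! i # take i \<sigma> @ drop (Suc i) \<sigma>)) = \<sigma>"
      using i len by simp
    have "mset (\<sigma> ! i # take i \<sigma> @ drop (Suc i) \<sigma>) = mset \<sigma>"
      by (subst (4) eq[symmetric]) simp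
    then have "distinct (\<sigma> ! i # take i \<sigma> @ drop (Suc i) \<sigma>) = distinct \<sigma>"
      "set (\<sigma> ! i # take i \<sigma> @ drop (Suc i) \<sigma>) = set \<sigma>"
      "length (\<sigma> ! i # take i \<sigma> @ drop (Suc i) \<sigma>) = length \<sigma>"
      by (metis mset_eq_imp_distinct_iff, metis mset_eq_setD, metis mset_eq_length)
    with \<sigma> show "\<sigma> ! i # take i \<sigma> @ drop (Suc i) \<sigma> \<in> ?L"
      by (simp add: ordered_cells_def)
  next
    fix \<tau> assume \<tau>: "\<tau> \<in> ?L"
    then obtain v l where vl: "\<tau> = v # l" "length l = k"
      by (auto simp: ordered_cells_def length_Suc_conv)
    let ?\<sigma> = "take i l @ v # drop i l"
    show "(take i (tl \<tau>) @ hd \<tau> # drop i (tl \<tau>)) ! i # take i (take i (tl \<tau>) @ hd \<tau> # drop i (tl \<tau>)) @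
        drop (Suc i) (take i (tl \<tau>) @ hd \<tau> # drop i (tl \<tau>)) = \<tau>"
      using i vl by (simp add: nth_append)
    have "mset ?\<sigma> = mset (v # l)"
      by (metis append_take_drop_id mset.simps(2) mset_append union_mset_add_mset_right)
    then have "distinct ?\<sigma> = distinct (v # l)" "set ?\<sigma> = set (v # l)" "length ?\<sigma> = length (v # l)"
      by (metis mset_eq_imp_distinct_iff, metis mset_eq_setD, metis mset_eq_length)
    with \<tau> vl show "take i (tl \<tau>) @ hd \<tau> # drop i (tl \<tau>) \<in> ?L"
      by (simp add: ordered_cells_def)
  qed simp
  have "dot ?L (coboundary X f) g
      = (\<Sum>\<sigma>\<in>?L. \<Sum>i<Suc k. (- 1) ^ i * f (take i \<sigma> @ drop (Suc i) \<sigma>) * g \<sigma>)"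
    unfolding dot_def
    by (intro sum.cong refl)
      (simp add: ordered_cells_def coboundary_def sum_distrib_right del: sum.lessThan_Suc)
  also have "\<dots> = (\<Sum>i<Suc k. \<Sum>\<sigma>\<in>?L. f (take i \<sigma> @ drop (Suc i) \<sigma>) * g (\<sigma> ! i # take i \<sigma> @ drop (Suc i) \<sigma>))"
    by (subst sum.swap) (intro sum.cong refl front; simp)
  also have "\<dots> = (\<Sum>i<Suc k. \<Sum>\<tau>\<in>?L. f (tl \<tau>) * g \<tau>)"
    by (intro sum.cong refl rotate) simp
  also have "\<dots> = real (Suc k) * (\<Sum>\<tau>\<in>?L. f (tl \<tau>) * g \<tau>)"
    by simp
  \<comment> \<open>The sum is enlarged to all pairs of an ordered cell and a vertex;
    \<open>g\<close> vanishes on the lists that are not ordered cells.\<close>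
  also have "(\<Sum>\<tau>\<in>?L. f (tl \<tau>) * g \<tau>)
      = (\<Sum>\<tau>\<in>(\<lambda>(\<sigma>, v). v # \<sigma>) ` (ordered_cells X k \<times> V). f (tl \<tau>) * g \<tau>)"
  proof (rule sum.mono_neutral_left)
    show "finite ((\<lambda>(\<sigma>, v). v # \<sigma>) ` (ordered_cells X k \<times> V))"
      by (simp add: finite_ordered_cells finite_V)
    show "?L \<subseteq> (\<lambda>(\<sigma>, v). v # \<sigma>) ` (ordered_cells X k \<times> V)"
    proof
      fix \<tau> assume \<tau>: "\<tau> \<in> ?L"
      then obtain v l where "\<tau> = v # l"
        by (auto simp: ordered_cells_def length_Suc_conv)
      with \<tau> ordered_cells_ConsD show "\<tau> \<in> (\<lambda>(\<sigma>, v). v # \<sigma>) ` (ordered_cells X k \<times> V)"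
        by force
    qed
    show "\<forall>\<tau>\<in>(\<lambda>(\<sigma>, v). v # \<sigma>) ` (ordered_cells X k \<times> V) - ?L. f (tl \<tau>) * g \<tau> = 0"
      using forms_support[OF g] by auto
  qed
  also have "\<dots> = (\<Sum>\<sigma>\<in>ordered_cells X k. \<Sum>v\<in>V. f \<sigma> * g (v # \<sigma>))"
    by (subst sum.reindex) (auto simp: inj_on_def sum.cartesian_product intro!: sum.cong)
  also have "\<dots> = dot (ordered_cells X k) f (boundary X g)"
    by (simp add: dot_def boundary_eq[OF g] sum_distrib_left)
  finally show ?thesis .
qed

text \<open>Two uses of adjointness turn the squared norm of the double coboundary into a pairing
  with a double boundary, which is 0.\<close>

lemma coboundary_coboundary:
  assumes "f \<in> forms X k"
  shows "coboundary X (coboundary X f) = (\<lambda>_. 0)"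
proof (rule dot_self_eq_0[OF finite_ordered_cells])
  let ?h = "coboundary X (coboundary X f)"
  have h: "?h \<in> forms X (Suc (Suc k))" by (intro coboundary_forms assms)
  show "dot (ordered_cells X (Suc (Suc k))) ?h ?h = 0"
    by (simp add: coboundary_adjoint[OF coboundary_forms[OF assms] h]
        coboundary_adjoint[OF assms boundary_forms[OF h]] boundary_boundary[OF h])
  show "?h \<sigma> = 0" if "\<sigma> \<notin> ordered_cells X (Suc (Suc k))" for \<sigma>
    by (rule forms_support[OF h that])
qed

lemma upper_laplacian_forms: "f \<in> forms X k \<Longrightarrow> upper_laplacian X f \<in> forms X k"
  unfolding upper_laplacian_def by (intro boundary_forms coboundary_forms)

lemma dot_upper_laplacian:
  assumes "f \<in> forms X k" "g \<in> forms X k"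
  shows "real (Suc k) * dot (ordered_cells X k) (upper_laplacian X f) g
    = dot (ordered_cells X (Suc k)) (coboundary X f) (coboundary X g)"
  using coboundary_adjoint[OF assms(2) coboundary_forms[OF assms(1)]]
  by (simp add: upper_laplacian_def dot_commute)

lemma upper_laplacian_symmetric:
  assumes "f \<in> forms X k" "g \<in> forms X k"
  shows "dot (ordered_cells X k) (upper_laplacian X f) g
    = dot (ordered_cells X k) f (upper_laplacian X g)"
proof -
  have "real (Suc k) * dot (ordered_cells X k) (upper_laplacian X f) g
      = real (Suc k) * dot (ordered_cells X k) (upper_laplacian X g) f"
    unfolding dot_upper_laplacian[OF assms] dot_upper_laplacian[OF assms(2,1)]
    by (rule dot_commute)
  then show ?thesis
    by (simp add: dot_commute[of _ f] del: of_nat_Suc)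
qed

text \<open>On the complete complex the sum of the upper and the lower Laplacian is multiplication
  by \<open>|V|\<close>; on a boundary the lower Laplacian vanishes.\<close>
lemma upper_laplacian_boundary:
  assumes skel: "complete_skeleton V X d" and kd: "Suc k \<le> d" and f: "f \<in> forms X (Suc k)"
  defines "g \<equiv> boundary X f"
  shows "upper_laplacian X g = (\<lambda>\<sigma>. real (card V) * g \<sigma>)"
proof
  fix \<sigma>
  have g: "g \<in> forms X k" unfolding g_def by (rule boundary_forms[OF f])
  show "upper_laplacian X g \<sigma> = real (card V) * g \<sigma>"
  proof (cases "\<sigma> \<in> ordered_cells X k")
    case False
    then show ?thesis
      using forms_support[OF upper_laplacian_forms[OF g]] forms_support[OF g] by simp
  next
    case True
    then have \<sigma>: "distinct \<sigma>" "set \<sigma> \<in> X" "length \<sigma> = k" "set \<sigma> \<subseteq> V"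
      using cell_subset by (auto simp: ordered_cells_def)
    \<comment> \<open>The new set has \<open>k + 1 \<le> d\<close> vertices, so the complete
      skeleton contains it: at this level \<open>X\<close> agrees with the complete complex.\<close>
    have cell: "insert v (set \<sigma>) \<in> X" if "v \<in> V" "v \<notin> set \<sigma>" for v
      using skel that \<sigma> kd unfolding complete_skeleton_def
      by (auto simp: distinct_card)
    \<comment> \<open>Over all of \<open>V\<close> the sum is 0 because \<open>g\<close> is a
      boundary. The part over \<open>set \<sigma>\<close> has a single nonzero term, the one that
      restores the deleted vertex.\<close>
    have inner: "(\<Sum>v\<in>V - set \<sigma>. g (v # take i \<sigma> @ drop (Suc i) \<sigma>)) = - ((- 1) ^ i * g \<sigma>)"
      if i: "i < k" for i
    proof -
      let ?l = "take i \<sigma> @ drop (Suc i) \<sigma>"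
      have split: "take i \<sigma> @ \<sigma> ! i # drop (Suc i) \<sigma> = \<sigma>"
        using id_take_nth_drop[of i \<sigma>] i \<sigma> by simp
      have "set \<sigma> = insert (\<sigma> ! i) (set ?l)"
        by (subst split[symmetric]) simp
      then have "(\<Sum>v\<in>set \<sigma>. g (v # ?l)) = (\<Sum>v\<in>{\<sigma> ! i}. g (v # ?l))"
        by (intro sum.mono_neutral_right) (auto intro!: forms_not_distinct[OF g])
      also have "\<dots> = (- 1) ^ i * g \<sigma>"
        using alternating_move_to_front[OF forms_alternating[OF g],
            of "take i \<sigma>" "\<sigma> ! i" "drop (Suc i) \<sigma>"] split i \<sigma>
        by simp
      finally have "(\<Sum>v\<in>set \<sigma>. g (v # ?l)) = (- 1) ^ i * g \<sigma>" .
      moreover have "(\<Sum>v\<in>V. g (v # ?l)) = 0"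
        unfolding g_def by (rule sum_boundary[OF f])
      ultimately show ?thesis
        using sum.subset_diff[OF \<sigma>(4) finite_V, of "\<lambda>v. g (v # ?l)"] by simp
    qed
    have "upper_laplacian X g \<sigma> = (\<Sum>v\<in>V - set \<sigma>. coboundary X g (v # \<sigma>))"
      unfolding upper_laplacian_def boundary_def
      by (rule sum.cong) (use cell cell_subset in auto)
    also have "\<dots> = (\<Sum>v\<in>V - set \<sigma>. g \<sigma> - alternating_sum (\<lambda>l. g (v # l)) \<sigma>)"
      by (rule sum.cong) (use cell \<sigma> in \<open>auto simp: coboundary_eq\<close>)
    also have "\<dots> = real (card (V - set \<sigma>)) * g \<sigma>
        - (\<Sum>i<k. (- 1) ^ i * (\<Sum>v\<in>V - set \<sigma>. g (v # take i \<sigma> @ drop (Suc i) \<sigma>)))"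
      unfolding sum_subtractf alternating_sum_def \<sigma>(3) sum_distrib_left
      by (subst (2) sum.swap) simp
    also have "(\<Sum>i<k. (- 1) ^ i * (\<Sum>v\<in>V - set \<sigma>. g (v # take i \<sigma> @ drop (Suc i) \<sigma>)))
        = (\<Sum>i<k. - g \<sigma>)"
      by (intro sum.cong refl) (simp add: inner mult.assoc[symmetric] power_mult_distrib[symmetric])
    \<comment> \<open>The \<open>k\<close> vertices of \<open>\<sigma>\<close> missing from this
      count are made up for by the \<open>k\<close> terms \<open>- g \<sigma>\<close> that are
      subtracted.\<close>
    also have "real (card (V - set \<sigma>)) = real (card V) - real k"
      using \<sigma> finite_V card_mono[OF finite_V \<sigma>(4)]
      by (simp add: card_Diff_subset distinct_card of_nat_diff)
    finally show ?thesis by (simp add: algebra_simps)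
  qed
qed

section \<open>The orthogonal projection onto the cycles\<close>

definition cycle_part :: "('a list \<Rightarrow> real) \<Rightarrow> 'a list \<Rightarrow> real" where
  "cycle_part f = (\<lambda>\<sigma>. f \<sigma> - inverse (real (card V)) * coboundary X (boundary X f) \<sigma>)"

context
  fixes k :: nat
  assumes skeleton: "complete_skeleton V X (Suc k)" and nonempty: "V \<noteq> {}"
begin

text \<open>By \<open>upper_laplacian_boundary\<close>, the boundary of the coboundary of
  \<open>boundary X f\<close> is \<open>card V\<close> times \<open>boundary X f\<close>, so the
  correction in \<open>cycle_part\<close> cancels the boundary of \<open>f\<close>.\<close>

lemma cycle_part_cycles:
  assumes f: "f \<in> forms X (Suc k)"
  shows "cycle_part f \<in> cycles X (Suc k)"
proof -
  have "boundary X (coboundary X (boundary X f)) = (\<lambda>\<sigma>. real (card V) * boundary X f \<sigma>)"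
    using upper_laplacian_boundary[OF skeleton _ f] by (simp add: upper_laplacian_def)
  then have "boundary X (cycle_part f) = (\<lambda>_. 0)"
    using nonempty finite_V
    by (simp add: cycle_part_def boundary_diff boundary_scale mult.assoc[symmetric])
  moreover have "cycle_part f \<in> forms X (Suc k)"
    unfolding cycle_part_def by (intro forms_diff forms_scale coboundary_forms boundary_forms f)
  ultimately show ?thesis by (simp add: cycles_def)
qed

text \<open>The part removed is a coboundary, and the upper Laplacian kills coboundaries.\<close>

lemma upper_laplacian_cycle_part:
  assumes f: "f \<in> forms X (Suc k)"
  shows "upper_laplacian X (cycle_part f) = upper_laplacian X f"
  by (simp add: upper_laplacian_def cycle_part_def coboundary_diff coboundary_scale
      coboundary_coboundary[OF boundary_forms[OF f]])

text \<open>Cycles are orthogonal to coboundaries by adjointness.\<close>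

lemma dot_cycle_part:
  assumes f: "f \<in> cycles X (Suc k)" and g: "g \<in> forms X (Suc k)"
  shows "dot (ordered_cells X (Suc k)) f (cycle_part g) = dot (ordered_cells X (Suc k)) f g"
proof -
  have "dot (ordered_cells X (Suc k)) (coboundary X (boundary X g)) f = 0"
    using f coboundary_adjoint[OF boundary_forms[OF g], of f] by (simp add: cycles_def)
  then show ?thesis
    by (simp add: cycle_part_def dot_linear dot_commute[of _ f])
qed

text \<open>The loss in squared norm is a nonnegative multiple of the squared norm of
  \<open>boundary X f\<close>.\<close>

lemma dot_cycle_part_self_le:
  assumes f: "f \<in> forms X (Suc k)"
  shows "dot (ordered_cells X (Suc k)) (cycle_part f) (cycle_part f)
    \<le> dot (ordered_cells X (Suc k)) f f"
proof -
  have "dot (ordered_cells X (Suc k)) (cycle_part f) (cycle_part f)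
      = dot (ordered_cells X (Suc k)) (cycle_part f) f"
    by (rule dot_cycle_part[OF cycle_part_cycles[OF f] f])
  also have "\<dots> = dot (ordered_cells X (Suc k)) f f - inverse (real (card V)) *
      (real (Suc k) * dot (ordered_cells X k) (boundary X f) (boundary X f))"
    by (simp add: cycle_part_def dot_linear coboundary_adjoint[OF boundary_forms[OF f] f])
  finally show ?thesis by (simp add: dot_self_nonneg)
qed

end

lemma closed_cycles: "closed (cycles X k)"
proof -
  have "cycles X k = forms X k \<inter> (\<Inter>\<sigma>. {f. boundary X f \<sigma> = 0})"
    by (auto simp: cycles_def)
  moreover have "closed \<dots>"
    by (intro closed_Int closed_INT ballI closed_forms closed_Collect_eq
        continuous_on_boundary continuous_on_const)
  ultimately show ?thesis by simp
qed

text \<open>The cycles are invariant because the upper Laplacian of a form is a boundary; symmetry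
  is inherited from \<open>upper_laplacian_symmetric\<close>.\<close>

lemma symmetric_operator_cycles:
  "symmetric_operator (ordered_cells X (Suc k)) (cycles X (Suc k)) (\<lambda>f \<sigma>. \<alpha> * f \<sigma> - upper_laplacian X f \<sigma>)"
proof
  show "finite (ordered_cells X (Suc k))" by (rule finite_ordered_cells)
  show "closed (cycles X (Suc k))" by (rule closed_cycles)
next
  fix f g assume "f \<in> cycles X (Suc k)" "g \<in> cycles X (Suc k)"
  then show "(\<lambda>\<sigma>. f \<sigma> + g \<sigma>) \<in> cycles X (Suc k)"
    by (simp add: cycles_def forms_add boundary_add)
next
  fix f c assume "f \<in> cycles X (Suc k)"
  then show "(\<lambda>\<sigma>. c * f \<sigma>) \<in> cycles X (Suc k)"
    by (simp add: cycles_def forms_scale boundary_scale)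
next
  fix f \<sigma> assume "f \<in> cycles X (Suc k)" "\<sigma> \<notin> ordered_cells X (Suc k)"
  then show "f \<sigma> = 0" by (auto simp: cycles_def dest: forms_support)
next
  fix f assume f: "f \<in> cycles X (Suc k)"
  then have coboundary_f: "coboundary X f \<in> forms X (Suc (Suc k))" by (auto simp: cycles_def intro: coboundary_forms)
  from boundary_boundary[OF coboundary_f] f
  show "(\<lambda>\<sigma>. \<alpha> * f \<sigma> - upper_laplacian X f \<sigma>) \<in> cycles X (Suc k)"
    by (simp add: cycles_def forms_scale forms_diff upper_laplacian_forms boundary_diff boundary_scale)
      (simp add: upper_laplacian_def)
next
  fix f g :: "'a list \<Rightarrow> real" 
  show "(\<lambda>\<sigma>. \<alpha> * (f \<sigma> + g \<sigma>) - upper_laplacian X (\<lambda>\<sigma>. f \<sigma> + g \<sigma>) \<sigma>) =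
      (\<lambda>\<sigma>. \<alpha> * f \<sigma> - upper_laplacian X f \<sigma> + (\<alpha> * g \<sigma> - upper_laplacian X g \<sigma>))"
    by (simp add: upper_laplacian_def coboundary_add boundary_add algebra_simps)
next
  fix f :: "'a list \<Rightarrow> real" and c
  show "(\<lambda>\<sigma>. \<alpha> * (c * f \<sigma>) - upper_laplacian X (\<lambda>\<sigma>. c * f \<sigma>) \<sigma>) =
      (\<lambda>\<sigma>. c * (\<alpha> * f \<sigma> - upper_laplacian X f \<sigma>))"
    by (simp add: upper_laplacian_def coboundary_scale boundary_scale algebra_simps)
next
  fix f g assume "f \<in> cycles X (Suc k)" "g \<in> cycles X (Suc k)"
  then show "dot (ordered_cells X (Suc k)) (\<lambda>\<sigma>. \<alpha> * f \<sigma> - upper_laplacian X f \<sigma>) g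
      = dot (ordered_cells X (Suc k)) f (\<lambda>\<sigma>. \<alpha> * g \<sigma> - upper_laplacian X g \<sigma>)"
    by (simp add: cycles_def dot_linear upper_laplacian_symmetric)
next
  fix \<sigma>
  show "continuous_on UNIV (\<lambda>f. \<alpha> * f \<sigma> - upper_laplacian X f \<sigma>)"
    by (intro continuous_intros continuous_on_product_coordinates continuous_on_upper_laplacian)
qed

end

section \<open>Block forms and transversals\<close>

definition transversals :: "(nat \<Rightarrow> 'a set) \<Rightarrow> nat \<Rightarrow> 'a list set" where
  "transversals A k = {\<sigma>. length \<sigma> = k \<and> (\<forall>i<k. \<sigma> ! i \<in> A i)}"

text \<open>This is the determinant of the 0-1 matrix with entries
  \<open>of_bool (\<sigma> ! j \<in> A i)\<close>. Without division by a factorial, its value on a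
  transversal of disjoint blocks is 1.\<close>

definition block_form :: "(nat \<Rightarrow> 'a set) \<Rightarrow> nat \<Rightarrow> 'a list \<Rightarrow> real" where
  "block_form A k \<sigma> = (if length \<sigma> = k
     then \<Sum>p | p permutes {..<k}. of_int (sign p) * of_bool (permute_list p \<sigma> \<in> transversals A k)
     else 0)"

lemma Cons_transversals:
  "v # \<sigma> \<in> transversals A (Suc k) \<longleftrightarrow> v \<in> A 0 \<and> \<sigma> \<in> transversals (A \<circ> Suc) k"
  by (auto simp: transversals_def All_less_Suc2)

lemma snoc_transversals:
  "\<sigma> @ [w] \<in> transversals A (Suc k) \<longleftrightarrow> \<sigma> \<in> transversals A k \<and> w \<in> A k"
  by (auto simp: transversals_def All_less_Suc nth_append)

lemma transversals_Suc:
  "transversals A (Suc k) = (\<lambda>(v, \<sigma>). v # \<sigma>) ` (A 0 \<times> transversals (A \<circ> Suc) k)"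
proof -
  have "\<exists>v l. \<sigma> = v # l" if "\<sigma> \<in> transversals A (Suc k)" for \<sigma>
    using that by (auto simp: transversals_def length_Suc_conv)
  then show ?thesis by (fastforce simp: Cons_transversals)
qed

lemma sum_transversals_Suc:
  "(\<Sum>\<sigma>\<in>transversals A (Suc k). f \<sigma>)
    = (\<Sum>v\<in>A 0. \<Sum>\<sigma>\<in>transversals (A \<circ> Suc) k. f (v # \<sigma>))"
  unfolding transversals_Suc
  by (subst sum.reindex) (auto simp: inj_on_def sum.cartesian_product intro!: sum.cong)

lemma card_transversals: "card (transversals A k) = (\<Prod>i<k. card (A i))"
proof (induction k arbitrary: A)
  case 0
  have "transversals A 0 = {[]}" by (auto simp: transversals_def)
  then show ?case by simp
next
  case (Suc k)
  have "card (transversals A (Suc k)) = card (A 0 \<times> transversals (A \<circ> Suc) k)"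
    unfolding transversals_Suc by (rule card_image) (auto simp: inj_on_def)
  then show ?case
    by (simp add: Suc card_cartesian_product prod.lessThan_Suc_shift del: prod.lessThan_Suc)
qed

lemma disjoint_family_on_index_unique:
  "disjoint_family_on A I \<Longrightarrow> x \<in> A i \<Longrightarrow> x \<in> A j \<Longrightarrow> i \<in> I \<Longrightarrow> j \<in> I \<Longrightarrow> i = j"
  by (auto simp: disjoint_family_on_def)

lemma distinct_transversal:
  assumes "disjoint_family_on A {..<k}" "\<sigma> \<in> transversals A k"
  shows "distinct \<sigma>"
  unfolding distinct_conv_nth
proof (intro allI impI)
  fix i j assume ij: "i < length \<sigma>" "j < length \<sigma>" "i \<noteq> j"
  with assms(2) have "\<sigma> ! i \<in> A i" "\<sigma> ! j \<in> A j" "i < k" "j < k"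
    by (auto simp: transversals_def)
  then show "\<sigma> ! i \<noteq> \<sigma> ! j"
    using disjoint_family_on_index_unique[OF assms(1), of "\<sigma> ! i" i j] ij(3) by auto
qed

lemma transversal_Int:
  assumes "disjoint_family_on A {..<k}" "\<sigma> \<in> transversals A k" "i < k"
  shows "set \<sigma> \<inter> A i = {\<sigma> ! i}"
proof -
  have "x = \<sigma> ! i" if "x \<in> set \<sigma>" "x \<in> A i" for x
  proof -
    obtain j where j: "j < k" "x = \<sigma> ! j"
      using \<open>x \<in> set \<sigma>\<close> assms(2) by (auto simp: in_set_conv_nth transversals_def)
    then have "x \<in> A j" using assms(2) by (auto simp: transversals_def)
    with disjoint_family_on_index_unique[OF assms(1) that(2) this] j assms(3) show ?thesis by simp
  qed
  then show ?thesis using assms by (auto simp: transversals_def)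
qed

lemma transversals_subset: "\<sigma> \<in> transversals A k \<Longrightarrow> x \<in> set \<sigma> \<Longrightarrow> \<exists>i<k. x \<in> A i"
  by (auto simp: transversals_def in_set_conv_nth)

lemma block_form_nonzeroE:
  assumes "block_form A k \<sigma> \<noteq> 0"
  obtains p where "length \<sigma> = k" "p permutes {..<k}" "permute_list p \<sigma> \<in> transversals A k"
proof -
  have "length \<sigma> = k"
    "(\<Sum>p | p permutes {..<k}. of_int (sign p) * of_bool (permute_list p \<sigma> \<in> transversals A k)) \<noteq> (0::real)"
    using assms by (auto simp: block_form_def split: if_splits)
  with that show thesis by (metis (mono_tags, lifting) mem_Collect_eq mult_zero_right of_bool_eq(1) sum.not_neutral_contains_not_neutral)
qed

text \<open>Replacing the summation variable \<open>p\<close> by \<open>q \<circ> p\<close> costs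
  the factor \<open>sign q\<close>, which is its own inverse.\<close>

lemma block_form_permute_list:
  assumes q: "q permutes {..<k}" and len: "length \<sigma> = k"
  shows "block_form A k (permute_list q \<sigma>) = of_int (sign q) * block_form A k \<sigma>"
proof -
  let ?P = "{p. p permutes {..<k}}"
  have "block_form A k (permute_list q \<sigma>)
      = (\<Sum>p\<in>?P. of_int (sign p) * of_bool (permute_list (q \<circ> p) \<sigma> \<in> transversals A k))"
    using len by (simp add: block_form_def permute_list_compose)
  also have "\<dots> = (\<Sum>p\<in>?P. of_int (sign q) *
      (of_int (sign (q \<circ> p)) * of_bool (permute_list (q \<circ> p) \<sigma> \<in> transversals A k)))"
  proof (rule sum.cong[OF refl])
    fix p assume "p \<in> ?P"
    then have "permutation p" "permutation q"
      using q finite_lessThan by (auto simp: permutation_permutes)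
    then have "(of_int (sign q) * of_int (sign (q \<circ> p)) :: real) = of_int (sign p)"
      by (simp add: sign_compose flip: of_int_mult)
    then show "of_int (sign p) * of_bool (permute_list (q \<circ> p) \<sigma> \<in> transversals A k) = (of_int (sign q) *
      (of_int (sign (q \<circ> p)) * of_bool (permute_list (q \<circ> p) \<sigma> \<in> transversals A k)) :: real)"
      by (simp add: mult.assoc[symmetric])
  qed
  also have "\<dots> = of_int (sign q) * (\<Sum>p\<in>?P. of_int (sign (q \<circ> p)) *
      of_bool (permute_list (q \<circ> p) \<sigma> \<in> transversals A k))"
    by (simp add: sum_distrib_left)
  also have "(\<Sum>p\<in>?P. of_int (sign (q \<circ> p)) * of_bool (permute_list (q \<circ> p) \<sigma> \<in> transversals A k))
      = block_form A k \<sigma>"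
    using setum_permutations_compose_left[OF q, symmetric,
        of "\<lambda>p. of_int (sign p) * of_bool (permute_list p \<sigma> \<in> transversals A k)"] len
    by (simp add: block_form_def)
  finally show ?thesis .
qed

lemma block_form_forms:
  assumes sub: "transversals A k \<subseteq> ordered_cells X k"
  shows "block_form A k \<in> forms X k"
  unfolding forms_def
proof (intro CollectI conjI allI impI ballI)
  fix \<sigma> assume \<sigma>: "\<sigma> \<notin> ordered_cells X k"
  show "block_form A k \<sigma> = 0"
  proof (rule ccontr)
    assume "block_form A k \<sigma> \<noteq> 0"
    then obtain p where p: "length \<sigma> = k" "p permutes {..<k}" "permute_list p \<sigma> \<in> transversals A k"
      by (rule block_form_nonzeroE)
    with sub have "permute_list p \<sigma> \<in> ordered_cells X k" by blast
    with p \<sigma> show False by (simp add: ordered_cells_def)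
  qed
next
  fix \<sigma> p assume "\<sigma> \<in> ordered_cells X k" "p permutes {..<k}"
  then show "block_form A k (permute_list p \<sigma>)
      = (if evenperm p then block_form A k \<sigma> else - block_form A k \<sigma>)"
    by (simp add: block_form_permute_list ordered_cells_def sign_def)
qed

text \<open>If \<open>p\<close> contributes, the entry at position \<open>p i\<close> lies in both
  \<open>A i\<close> and \<open>A (p i)\<close>; disjointness leaves only the identity.\<close>

lemma block_form_transversal:
  assumes disj: "disjoint_family_on A {..<k}" and \<sigma>: "\<sigma> \<in> transversals A k"
  shows "block_form A k \<sigma> = 1"
proof -
  have len: "length \<sigma> = k" using \<sigma> by (simp add: transversals_def)
  have "p = id" if p: "p permutes {..<k}" "permute_list p \<sigma> \<in> transversals A k" for p
  proof
    fix i
    show "p i = id i"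
    proof (cases "i < k")
      case True
      then have pi: "p i < k" using permutes_in_image[OF p(1), of i] by simp
      have "\<sigma> ! p i \<in> A i" "\<sigma> ! p i \<in> A (p i)"
        using p \<sigma> True pi len by (auto simp: transversals_def permute_list_nth)
      with disjoint_family_on_index_unique[OF disj this] True pi show ?thesis by simp
    next
      case False
      then show ?thesis using p(1) by (simp add: permutes_not_in)
    qed
  qed
  then have "of_bool (permute_list p \<sigma> \<in> transversals A k) = (if p = id then 1 else 0 :: real)"
    if "p permutes {..<k}" for p
    using \<sigma> that by auto
  then have "block_form A k \<sigma> = (\<Sum>p | p permutes {..<k}. if p = id then of_int (sign p) else 0)"
    using len by (auto simp: block_form_def intro!: sum.cong)
  then show ?thesis by (simp add: finite_permutations permutes_id sign_id)
qed

lemma block_form_eq_0: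
  assumes "w \<in> set \<sigma>" "\<And>i. i < k \<Longrightarrow> w \<notin> A i"
  shows "block_form A k \<sigma> = 0"
proof (rule ccontr)
  assume "block_form A k \<sigma> \<noteq> 0"
  then obtain p where p: "length \<sigma> = k" "p permutes {..<k}" "permute_list p \<sigma> \<in> transversals A k"
    by (rule block_form_nonzeroE)
  then have "w \<in> set (permute_list p \<sigma>)" using assms(1) by simp
  with transversals_subset[OF p(3)] assms(2) show False by blast
qed

text \<open>The tail already occupies the blocks after the first, so a nonzero value forces the free
  entry \<open>v\<close> into \<open>A 0\<close>. This evaluates the boundary of a block
  form.\<close>

lemma block_form_Cons:
  assumes disj: "disjoint_family_on A {..<Suc k}" and \<tau>: "\<tau> \<in> transversals (A \<circ> Suc) k"
  shows "block_form A (Suc k) (v # \<tau>) = of_bool (v \<in> A 0)"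
proof (cases "v \<in> A 0")
  case True
  with \<tau> have "v # \<tau> \<in> transversals A (Suc k)" by (simp add: Cons_transversals)
  then show ?thesis using True by (simp add: block_form_transversal[OF disj])
next
  case False
  have "block_form A (Suc k) (v # \<tau>) = 0"
  proof (rule ccontr)
    assume "block_form A (Suc k) (v # \<tau>) \<noteq> 0"
    then obtain p where p: "length (v # \<tau>) = Suc k" "p permutes {..<Suc k}"
        "permute_list p (v # \<tau>) \<in> transversals A (Suc k)"
      by (rule block_form_nonzeroE)
    then have "permute_list p (v # \<tau>) ! 0 \<in> set (v # \<tau>)" "permute_list p (v # \<tau>) ! 0 \<in> A 0"
      using nth_mem[of 0 "permute_list p (v # \<tau>)"] set_permute_list[of p "v # \<tau>"]
      by (simp, simp add: transversals_def)
    with False obtain x where x: "x \<in> set \<tau>" "x \<in> A 0" by auto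
    with transversals_subset[OF \<tau>] obtain i where "i < k" "x \<in> A (Suc i)" by auto
    with disjoint_family_on_index_unique[OF disj x(2), of "Suc i"] show False by simp
  qed
  with False show ?thesis by simp
qed

section \<open>Inner products with block forms and the count of crossing cells\<close>

context vertex_complex
begin

text \<open>The sign in the block form is absorbed by \<open>f\<close>, which is alternating. Each
  of the \<open>fact k\<close> permutations then only reindexes the sum over orderings.\<close>

lemma dot_block_form:
  assumes f: "f \<in> forms X k" and sub: "transversals A k \<subseteq> ordered_cells X k"
  shows "dot (ordered_cells X k) (block_form A k) f = fact k * sum f (transversals A k)"
proof -
  let ?L = "ordered_cells X k" and ?P = "{p. p permutes {..<k}}"
  define h where "h \<tau> = of_bool (\<tau> \<in> transversals A k) * f \<tau>" for \<tau>
  have "dot ?L (block_form A k) f = (\<Sum>\<sigma>\<in>?L. \<Sum>p\<in>?P. h (permute_list p \<sigma>))"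
    unfolding dot_def
  proof (rule sum.cong[OF refl])
    fix \<sigma> assume \<sigma>: "\<sigma> \<in> ?L"
    then have len: "length \<sigma> = k" by (simp add: ordered_cells_def)
    have "f (permute_list p \<sigma>) = of_int (sign p) * f \<sigma>" if "p \<in> ?P" for p
      using alternating_permute_list[OF forms_alternating[OF f], of p \<sigma>] that len by simp
    then show "block_form A k \<sigma> * f \<sigma> = (\<Sum>p\<in>?P. h (permute_list p \<sigma>))"
      using len by (auto simp: block_form_def h_def sum_distrib_right intro!: sum.cong)
  qed
  also have "\<dots> = (\<Sum>p\<in>?P. \<Sum>\<sigma>\<in>?L. h (permute_list p \<sigma>))"
    by (rule sum.swap)
  also have "\<dots> = (\<Sum>p\<in>?P. \<Sum>\<sigma>\<in>?L. h \<sigma>)"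
  proof (rule sum.cong[OF refl])
    fix p assume "p \<in> ?P"
    then have p: "p permutes {..<k}" by simp
    have inv: "inv p permutes {..<k}" by (rule permutes_inv[OF p])
    have "permute_list (inv p) (permute_list p \<sigma>) = \<sigma>" "permute_list p (permute_list (inv p) \<sigma>) = \<sigma>"
      if "\<sigma> \<in> ?L" for \<sigma>
      using that p inv permute_list_compose[of "inv p" \<sigma> p] permute_list_compose[of p \<sigma> "inv p"]
        permutes_inv_o[OF p]
      by (auto simp: ordered_cells_def)
    then show "(\<Sum>\<sigma>\<in>?L. h (permute_list p \<sigma>)) = (\<Sum>\<sigma>\<in>?L. h \<sigma>)"
      by (intro sum.reindex_bij_witness[where i = "permute_list (inv p)" and j = "permute_list p"])
        (auto intro: ordered_cells_permute_list p inv)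
  qed
  also have "\<dots> = fact k * (\<Sum>\<sigma>\<in>?L. h \<sigma>)"
    by (simp add: card_permutations)
  also have "(\<Sum>\<sigma>\<in>?L. h \<sigma>) = (\<Sum>\<sigma>\<in>transversals A k. h \<sigma>)"
    by (rule sum.mono_neutral_right[OF finite_ordered_cells sub]) (simp add: h_def)
  also have "\<dots> = sum f (transversals A k)"
    by (rule sum.cong) (auto simp: h_def)
  finally show ?thesis .
qed

lemma dot_block_form_self:
  assumes "disjoint_family_on A {..<k}" and sub: "transversals A k \<subseteq> ordered_cells X k"
  shows "dot (ordered_cells X k) (block_form A k) (block_form A k)
    = fact k * (\<Prod>i<k. real (card (A i)))"
proof -
  have "sum (block_form A k) (transversals A k) = real (card (transversals A k))"
    using block_form_transversal[OF assms(1)] by simp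
  then show ?thesis
    by (simp add: dot_block_form[OF block_form_forms[OF sub] sub] card_transversals)
qed

lemma transversals_ordered_cells:
  assumes skel: "complete_skeleton V X d" and "k \<le> d"
    and disj: "disjoint_family_on A {..<k}" and sub: "\<And>i. i < k \<Longrightarrow> A i \<subseteq> V"
  shows "transversals A k \<subseteq> ordered_cells X k"
proof
  fix \<sigma> assume \<sigma>: "\<sigma> \<in> transversals A k"
  have "distinct \<sigma>" by (rule distinct_transversal[OF disj \<sigma>])
  moreover have "set \<sigma> \<subseteq> V" using transversals_subset[OF \<sigma>] sub by blast
  moreover have "length \<sigma> = k" using \<sigma> by (simp add: transversals_def)
  ultimately show "\<sigma> \<in> ordered_cells X k"
    using skel \<open>k \<le> d\<close> by (auto simp: ordered_cells_def complete_skeleton_def distinct_card)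
qed

text \<open>The boundary of a single oriented top cell is a nonzero cycle. Hence the maximum in
  \<open>rho\<close> is taken over a nonempty set.\<close>

lemma cycles_nontrivial:
  assumes "cells X (Suc k) \<noteq> {}"
  shows "\<exists>f\<in>cycles X (Suc k). f \<noteq> (\<lambda>_. 0)"
proof -
  obtain s where s: "s \<in> X" "card s = Suc (Suc k)"
    using assms by (auto simp: cells_def)
  then have "finite s" by (simp add: card_ge_0_finite)
  then obtain \<rho> where \<rho>: "distinct \<rho>" "set \<rho> = s" "length \<rho> = Suc (Suc k)"
    using finite_distinct_list[of s] s(2) by (metis distinct_card)
  then obtain v \<tau> where v\<tau>: "\<rho> = v # \<tau>" by (auto simp: length_Suc_conv)
  \<comment> \<open>With singleton blocks the block form is the signed indicator of one cell; its
    boundary takes the value 1 on the facet \<open>\<tau>\<close> opposite \<open>v\<close>.\<close>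
  define A where "A i = {\<rho> ! i}" for i
  have disj: "disjoint_family_on A {..<Suc (Suc k)}"
    using \<rho> by (auto simp: A_def disjoint_family_on_def nth_eq_iff_index_eq)
  have "transversals A (Suc (Suc k)) = {\<rho>}"
    using \<rho>(3) by (auto simp: transversals_def A_def intro: nth_equalityI)
  then have sub: "transversals A (Suc (Suc k)) \<subseteq> ordered_cells X (Suc (Suc k))"
    using \<rho> s by (simp add: ordered_cells_def)
  define g where "g = block_form A (Suc (Suc k))"
  have g: "g \<in> forms X (Suc (Suc k))"
    unfolding g_def by (rule block_form_forms[OF sub])
  have "\<tau> \<in> transversals (A \<circ> Suc) (Suc k)"
    using \<rho>(3) by (simp add: transversals_def A_def v\<tau>)
  then have "boundary X g \<tau> = (\<Sum>w\<in>V. of_bool (w \<in> A 0))"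
    unfolding boundary_eq[OF g] unfolding g_def by (simp add: block_form_Cons[OF disj])
  also have "\<dots> = (\<Sum>w\<in>V. if w = v then 1 else 0)"
    by (intro sum.cong) (auto simp: A_def v\<tau>)
  also have "\<dots> = 1"
    using finite_V cell_subset[OF s(1)] \<rho>(2) v\<tau> by auto
  finally have "boundary X g \<noteq> (\<lambda>_. 0)" by auto
  moreover have "boundary X g \<in> cycles X (Suc k)"
    using boundary_forms[OF g] boundary_boundary[OF g] by (simp add: cycles_def)
  ultimately show ?thesis by blast
qed

text \<open>Disjointness gives each crossing cell exactly one ordering that is a transversal:
  position \<open>i\<close> holds its vertex in \<open>A i\<close>.\<close>

lemma card_crossing_cells:
  assumes disj: "disjoint_family_on A {..d}"
  shows "card (crossing_cells X d A) = card {\<rho> \<in> transversals A (Suc d). set \<rho> \<in> X}"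
proof -
  have disj': "disjoint_family_on A {..<Suc d}" using disj by (simp add: lessThan_Suc_atMost)
  have "bij_betw set {\<rho> \<in> transversals A (Suc d). set \<rho> \<in> X} (crossing_cells X d A)"
    unfolding bij_betw_def
  proof
    show "inj_on set {\<rho> \<in> transversals A (Suc d). set \<rho> \<in> X}"
    proof (rule inj_onI)
      fix \<rho> \<rho>' assume a: "\<rho> \<in> {\<rho> \<in> transversals A (Suc d). set \<rho> \<in> X}"
        "\<rho>' \<in> {\<rho> \<in> transversals A (Suc d). set \<rho> \<in> X}" "set \<rho> = set \<rho>'"
      then have t: "\<rho> \<in> transversals A (Suc d)" "\<rho>' \<in> transversals A (Suc d)" by auto
      have "\<rho> ! i = \<rho>' ! i" if "i < Suc d" for i
        using transversal_Int[OF disj' t(1) that] transversal_Int[OF disj' t(2) that] a(3) by simp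
      with t show "\<rho> = \<rho>'" by (intro nth_equalityI) (auto simp: transversals_def)
    qed
    show "set ` {\<rho> \<in> transversals A (Suc d). set \<rho> \<in> X} = crossing_cells X d A"
    proof (intro equalityI subsetI)
      fix s assume "s \<in> set ` {\<rho> \<in> transversals A (Suc d). set \<rho> \<in> X}"
      then obtain \<rho> where \<rho>: "\<rho> \<in> transversals A (Suc d)" "set \<rho> \<in> X" "s = set \<rho>" by auto
      have "card s = Suc d"
        using distinct_card[OF distinct_transversal[OF disj' \<rho>(1)]] \<rho> by (simp add: transversals_def)
      moreover have "card (s \<inter> A i) = 1" if "i \<le> d" for i
        using transversal_Int[OF disj' \<rho>(1), of i] that \<rho>(3) by simp
      ultimately show "s \<in> crossing_cells X d A"
        using \<rho> by (simp add: crossing_cells_def cells_def)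
    next
      fix s assume "s \<in> crossing_cells X d A"
      then have s: "s \<in> X" "card s = Suc d" "\<And>i. i \<le> d \<Longrightarrow> card (s \<inter> A i) = 1"
        by (auto simp: crossing_cells_def cells_def)
      have "\<exists>x. s \<inter> A i = {x}" if "i \<le> d" for i
        using s(3)[OF that] by (simp add: card_1_singleton_iff)
      then obtain x where x: "\<And>i. i \<le> d \<Longrightarrow> s \<inter> A i = {x i}" by metis
      define \<rho> where "\<rho> = map x [0..<Suc d]"
      have mem: "x i \<in> s \<and> x i \<in> A i" if "i \<le> d" for i
        using x[OF that] by auto
      have \<rho>: "\<rho> \<in> transversals A (Suc d)"
        using mem by (auto simp: transversals_def \<rho>_def simp del: upt_Suc)
      have "set \<rho> \<subseteq> s" using mem by (auto simp: \<rho>_def)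
      \<comment> \<open>Equal cardinality excludes further vertices of \<open>s\<close> outside the
        blocks.\<close>
      moreover have "card (set \<rho>) = card s"
        using distinct_card[OF distinct_transversal[OF disj' \<rho>]] s(2) by (simp add: \<rho>_def)
      moreover have "finite s" using s(2) by (simp add: card_ge_0_finite)
      ultimately have "set \<rho> = s" by (metis card_subset_eq)
      with \<rho> s(1) show "s \<in> set ` {\<rho> \<in> transversals A (Suc d). set \<rho> \<in> X}" by blast
    qed
  qed
  from bij_betw_same_card[OF this] show ?thesis by simp
qed

end

section \<open>The mixing inequality\<close>

text \<open>The square of each factor other than the two largest is at most
  \<open>a i * a j\<close>, and the two largest contribute
  \<open>(a i * a j)\<^sup>2\<close>.\<close>

lemma prod_power2_le:
  fixes a :: "'i \<Rightarrow> real"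
  assumes I: "finite I" "i \<in> I" "j \<in> I" "i \<noteq> j"
    and nonneg: "\<And>k. k \<in> I \<Longrightarrow> 0 \<le> a k"
    and le: "\<And>k. k \<in> I - {i, j} \<Longrightarrow> a k \<le> a i \<and> a k \<le> a j"
  shows "(\<Prod>k\<in>I. a k)\<^sup>2 \<le> (a i * a j) ^ card I"
proof -
  have "card I = card (I - {i, j}) + card {i, j}"
    using I card_mono[of I "{i, j}"] by (simp add: card_Diff_subset)
  then have card: "card I = card (I - {i, j}) + 2" using I by simp
  have "(\<Prod>k\<in>I. a k) = (\<Prod>k\<in>I - {i, j}. a k) * (\<Prod>k\<in>{i, j}. a k)"
    using I by (intro prod.subset_diff) auto
  then have "(\<Prod>k\<in>I. a k)\<^sup>2 = (\<Prod>k\<in>I - {i, j}. a k * a k) * (a i * a j)\<^sup>2"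
    using I by (simp add: power_mult_distrib power2_eq_square prod.distrib)
  also have "\<dots> \<le> (\<Prod>k\<in>I - {i, j}. a i * a j) * (a i * a j)\<^sup>2"
  proof (intro mult_right_mono prod_mono)
    fix k assume k: "k \<in> I - {i, j}"
    then show "0 \<le> a k * a k \<and> a k * a k \<le> a i * a j"
      using le[OF k] nonneg I by (auto intro!: mult_mono)
  qed simp
  also have "\<dots> = (a i * a j) ^ card I"
    by (simp add: card power_add power2_eq_square)
  finally show ?thesis .
qed

section \<open>The discrepancy bounded by an operator norm\<close>

context vertex_complex
begin

lemma rho_bound:
  fixes \<alpha> :: real
  assumes cell: "cells X (Suc k) \<noteq> {}" and f: "f \<in> cycles X (Suc k)" and g: "g \<in> cycles X (Suc k)"
  shows abs_dot_le_rho: "\<bar>dot (ordered_cells X (Suc k)) (\<lambda>\<sigma>. \<alpha> * f \<sigma> - upper_laplacian X f \<sigma>) g\<bar>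
      \<le> rho X (Suc k) \<alpha> * sqrt (dot (ordered_cells X (Suc k)) f f) *
        sqrt (dot (ordered_cells X (Suc k)) g g)"
    and rho_nonneg: "0 \<le> rho X (Suc k) \<alpha>"
proof -
  define T where "T f = (\<lambda>\<sigma>. \<alpha> * f \<sigma> - upper_laplacian X f \<sigma>)" for f
  interpret symmetric_operator "ordered_cells X (Suc k)" "cycles X (Suc k)" T
    unfolding T_def by (rule symmetric_operator_cycles)
  obtain f0 where f0: "f0 \<in> cycles X (Suc k)" "f0 \<noteq> (\<lambda>_. 0)"
    using cycles_nontrivial[OF cell] by blast
  have rho: "rho X (Suc k) \<alpha> = Max (abs ` eigenvalues)"
    by (simp add: rho_def restricted_eigenvalues_def eigenvalues_def T_def)
  show "\<bar>dot (ordered_cells X (Suc k)) (\<lambda>\<sigma>. \<alpha> * f \<sigma> - upper_laplacian X f \<sigma>) g\<bar>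
      \<le> rho X (Suc k) \<alpha> * sqrt (dot (ordered_cells X (Suc k)) f f) *
        sqrt (dot (ordered_cells X (Suc k)) g g)"
    using abs_dot_le_Max_eigenvalue(1)[OF f0 f g] by (simp add: rho T_def)
  show "0 \<le> rho X (Suc k) \<alpha>"
    using abs_dot_le_Max_eigenvalue(2)[OF f0 f g] by (simp add: rho)
qed

text \<open>The estimate holds for every order of the blocks; the two products omit the last and the
  first block respectively, being the squared norms of the two block forms up to a
  factorial.\<close>

lemma abs_crossing_cells_le:
  assumes skel: "complete_skeleton V X d" and d: "d \<ge> 1" and cell: "cells X d \<noteq> {}"
    and sub: "\<And>i. i \<le> d \<Longrightarrow> A i \<subseteq> V" and disj: "disjoint_family_on A {..d}"
  shows "\<bar>real (card (crossing_cells X d A)) - \<alpha> * (\<Prod>i\<le>d. real (card (A i))) / real (card V)\<bar>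
    \<le> rho X d \<alpha> * sqrt ((\<Prod>i<d. real (card (A i))) * (\<Prod>i<d. real (card (A (Suc i)))))"
proof -
  obtain k where dk: "d = Suc k" using d by (cases d) auto
  have ne: "V \<noteq> {}" using cell cell_subset by (fastforce simp: cells_def dk)
  note skel' = skel[unfolded dk]
  let ?L = "ordered_cells X (Suc k)"
  have disj': "disjoint_family_on A {..<Suc (Suc k)}"
    using disj by (simp add: dk lessThan_Suc_atMost)
  have disjA: "disjoint_family_on A {..<Suc k}"
    by (rule disjoint_family_on_mono[OF _ disj']) auto
  have disjB: "disjoint_family_on (A \<circ> Suc) {..<Suc k}"
    using disj' by (auto simp: disjoint_family_on_def)
  have trA: "transversals A (Suc k) \<subseteq> ?L"
    by (rule transversals_ordered_cells[OF skel' _ disjA]) (use sub dk in auto)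
  have trB: "transversals (A \<circ> Suc) (Suc k) \<subseteq> ?L"
    by (rule transversals_ordered_cells[OF skel' _ disjB]) (use sub dk in auto)
  define \<phi> where "\<phi> = block_form A (Suc k)"
  define \<psi> where "\<psi> = block_form (A \<circ> Suc) (Suc k)"
  have \<phi>: "\<phi> \<in> forms X (Suc k)" unfolding \<phi>_def by (rule block_form_forms[OF trA])
  have \<psi>: "\<psi> \<in> forms X (Suc k)" unfolding \<psi>_def by (rule block_form_forms[OF trB])
  \<comment> \<open>The number of vertices of \<open>A 0\<close> that complete
    \<open>\<sigma>\<close> to a cell.\<close>
  define c where "c \<sigma> = card {v \<in> A 0. insert v (set \<sigma>) \<in> X}" for \<sigma>
  have finA0: "finite (A 0)" using finite_subset[OF sub finite_V, of 0] by simp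
  \<comment> \<open>All three values use the last entry \<open>w\<close> of \<open>\<sigma>\<close>,
    which lies in the last block. Since \<open>\<phi>\<close> vanishes on lists containing
    \<open>w\<close>, only the terms that delete \<open>w\<close> survive, with sign
    \<open>(- 1) ^ k\<close>.\<close>
  have at_transversal: "\<phi> \<sigma> = 0" "coboundary X (boundary X \<phi>) \<sigma> = (- 1) ^ k * real (card (A 0))"
    "upper_laplacian X \<phi> \<sigma> = - ((- 1) ^ k * real (c \<sigma>))"
    if \<sigma>: "\<sigma> \<in> transversals (A \<circ> Suc) (Suc k)" for \<sigma>
  proof -
    have len: "length \<sigma> = Suc k" using \<sigma> by (simp add: transversals_def)
    then obtain \<tau> w where \<tau>w: "\<sigma> = \<tau> @ [w]"
      by (metis append_butlast_last_id length_0_conv nat.simps(3))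
    then have \<tau>: "\<tau> \<in> transversals (A \<circ> Suc) k" and w: "w \<in> A (Suc k)" and len\<tau>: "length \<tau> = k"
      using \<sigma> len by (simp_all add: snoc_transversals)
    have oc: "distinct \<sigma>" "set \<sigma> \<in> X"
      using \<sigma> trB by (auto simp: ordered_cells_def)
    have wA: "w \<notin> A i" if "i < Suc k" for i
      using disjoint_family_on_index_unique[OF disj' w, of i] that by auto
    have \<phi>w: "\<phi> l = 0" if "w \<in> set l" for l
      unfolding \<phi>_def by (rule block_form_eq_0[OF that wA])
    then show "\<phi> \<sigma> = 0" by (simp add: \<tau>w)
    have \<phi>\<tau>: "\<phi> (v # \<tau>) = of_bool (v \<in> A 0)" for v
      unfolding \<phi>_def by (rule block_form_Cons[OF disjA \<tau>])
    have "boundary X \<phi> \<tau> = (\<Sum>v\<in>V. of_bool (v \<in> A 0))"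
      by (simp add: boundary_eq[OF \<phi>] \<phi>\<tau>)
    also have "\<dots> = (\<Sum>v\<in>A 0. 1)"
      by (rule sum.mono_neutral_cong_right) (use sub finite_V in auto)
    finally have "boundary X \<phi> \<tau> = real (card (A 0))" by simp
    moreover have "boundary X \<phi> l = 0" if "w \<in> set l" for l
      by (simp add: boundary_eq[OF \<phi>] \<phi>w that)
    ultimately show "coboundary X (boundary X \<phi>) \<sigma> = (- 1) ^ k * real (card (A 0))"
      using oc len\<tau> alternating_sum_snoc[of w "boundary X \<phi>" \<tau>] by (simp add: coboundary_eq \<tau>w)
    \<comment> \<open>Deleting \<open>v\<close> leaves \<open>\<phi> \<sigma> = 0\<close>; in
      \<open>v # \<sigma>\<close> the entry \<open>w\<close> sits one place further back, which
      produces the extra minus sign.\<close>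
    have cob: "coboundary X \<phi> (v # \<sigma>) = - ((- 1) ^ k * of_bool (v \<in> A 0))"
      if "v \<notin> set \<sigma>" "insert v (set \<sigma>) \<in> X" for v
    proof -
      have "alternating_sum (\<lambda>l. \<phi> (v # l)) \<sigma> = (- 1) ^ k * of_bool (v \<in> A 0)"
        using alternating_sum_snoc[of w "\<lambda>l. \<phi> (v # l)" \<tau>] by (simp add: \<tau>w \<phi>w \<phi>\<tau> len\<tau>)
      with that oc \<open>\<phi> \<sigma> = 0\<close> show ?thesis by (simp add: coboundary_eq)
    qed
    have A0\<sigma>: "v \<notin> set \<sigma>" if "v \<in> A 0" for v
    proof
      assume "v \<in> set \<sigma>"
      with transversals_subset[OF \<sigma>] obtain i where "i < Suc k" "v \<in> A (Suc i)" by auto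
      with disjoint_family_on_index_unique[OF disj' that, of "Suc i"] show False by simp
    qed
    have "upper_laplacian X \<phi> \<sigma>
        = (\<Sum>v | v \<notin> set \<sigma> \<and> insert v (set \<sigma>) \<in> X. - ((- 1) ^ k * of_bool (v \<in> A 0)))"
      unfolding upper_laplacian_def boundary_def by (intro sum.cong refl) (simp add: cob)
    also have "\<dots> = (\<Sum>v\<in>{v \<in> A 0. insert v (set \<sigma>) \<in> X}. - ((- 1) ^ k))"
    proof (rule sum.mono_neutral_cong_right)
      show "finite {v. v \<notin> set \<sigma> \<and> insert v (set \<sigma>) \<in> X}"
        by (rule finite_subset[OF _ finite_V]) (use cell_subset in auto)
    qed (use A0\<sigma> in auto)
    finally show "upper_laplacian X \<phi> \<sigma> = - ((- 1) ^ k * real (c \<sigma>))"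
      by (simp add: c_def)
  qed
  \<comment> \<open>Each transversal of all blocks is split into its entry in \<open>A 0\<close> and
    the remaining transversal \<open>\<sigma>\<close>.\<close>
  have count: "(\<Sum>\<sigma>\<in>transversals (A \<circ> Suc) (Suc k). c \<sigma>) = card (crossing_cells X d A)"
  proof -
    have fin: "finite (transversals A (Suc (Suc k)))"
      unfolding transversals_Suc[of A "Suc k"]
      using finA0 finite_subset[OF trB finite_ordered_cells] by auto
    have "card (crossing_cells X d A)
        = (\<Sum>\<rho>\<in>transversals A (Suc (Suc k)). of_bool (set \<rho> \<in> X))"
      using card_crossing_cells[OF disj] fin by (simp add: dk sum_of_bool_eq Collect_conj_eq)
    also have "\<dots> = (\<Sum>v\<in>A 0. \<Sum>\<sigma>\<in>transversals (A \<circ> Suc) (Suc k). of_bool (insert v (set \<sigma>) \<in> X))"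
      by (simp add: sum_transversals_Suc[of _ A])
    also have "\<dots> = (\<Sum>\<sigma>\<in>transversals (A \<circ> Suc) (Suc k). c \<sigma>)"
      using finA0 by (subst sum.swap) (simp add: c_def sum_of_bool_eq Collect_conj_eq)
    finally show ?thesis by simp
  qed
  define T where "T f = (\<lambda>\<sigma>. \<alpha> * f \<sigma> - upper_laplacian X f \<sigma>)" for f
  define P where "P = (\<Prod>i\<le>d. real (card (A i)))"
  define r where "r = real (card (crossing_cells X d A)) - \<alpha> * P / real (card V)"
  note Z\<phi> = cycle_part_cycles[OF skel' ne \<phi>] and Z\<psi> = cycle_part_cycles[OF skel' ne \<psi>]
  have TZ: "T (cycle_part \<phi>) \<in> cycles X (Suc k)"
    unfolding T_def by (rule symmetric_operator.T_Z[OF symmetric_operator_cycles Z\<phi>])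
  \<comment> \<open>The term \<open>\<alpha> * \<phi> \<sigma>\<close> is 0. The subtracted
    coboundary and the subtracted Laplacian have opposite signs, so their difference is the local
    discrepancy at \<open>\<sigma>\<close>.\<close>
  have T\<phi>: "T (cycle_part \<phi>) \<sigma> = (- 1) ^ k * (real (c \<sigma>) - \<alpha> * real (card (A 0)) / real (card V))"
    if "\<sigma> \<in> transversals (A \<circ> Suc) (Suc k)" for \<sigma>
    by (simp add: T_def upper_laplacian_cycle_part[OF skel' ne \<phi>] at_transversal[OF that])
      (simp add: cycle_part_def at_transversal[OF that] field_simps)
  have P: "P = real (card (A 0)) * real (card (transversals (A \<circ> Suc) (Suc k)))"
    by (simp add: P_def card_transversals dk prod.atMost_Suc_shift lessThan_Suc_atMost
        del: prod.atMost_Suc)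
  have "dot ?L (T (cycle_part \<phi>)) (cycle_part \<psi>) = dot ?L (T (cycle_part \<phi>)) \<psi>"
    by (rule dot_cycle_part[OF skel' ne TZ \<psi>])
  also have "\<dots> = fact (Suc k) * (\<Sum>\<sigma>\<in>transversals (A \<circ> Suc) (Suc k). T (cycle_part \<phi>) \<sigma>)"
    unfolding dot_commute[of _ _ \<psi>] unfolding \<psi>_def
    using TZ by (intro dot_block_form[OF _ trB]) (simp add: cycles_def)
  also have "(\<Sum>\<sigma>\<in>transversals (A \<circ> Suc) (Suc k). T (cycle_part \<phi>) \<sigma>) = (- 1) ^ k * r"
    by (simp add: T\<phi> sum_subtractf r_def count[symmetric] P flip: sum_distrib_left)
  finally have "\<bar>dot ?L (T (cycle_part \<phi>)) (cycle_part \<psi>)\<bar> = fact (Suc k) * \<bar>r\<bar>"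
    by (simp add: abs_mult power_abs)
  then have "fact (Suc k) * \<bar>r\<bar> \<le> rho X d \<alpha> * sqrt (dot ?L (cycle_part \<phi>) (cycle_part \<phi>)) *
      sqrt (dot ?L (cycle_part \<psi>) (cycle_part \<psi>))"
    using abs_dot_le_rho[OF cell[unfolded dk] Z\<phi> Z\<psi>, of \<alpha>] by (simp add: T_def dk)
  also have "\<dots> \<le> rho X d \<alpha> * sqrt (dot ?L \<phi> \<phi>) * sqrt (dot ?L \<psi> \<psi>)"
    using rho_nonneg[OF cell[unfolded dk] Z\<phi> Z\<psi>, of \<alpha>]
    by (intro mult_mono mult_left_mono real_sqrt_le_mono dot_cycle_part_self_le[OF skel' ne] \<phi> \<psi>)
      (simp_all add: dk dot_self_nonneg)
  \<comment> \<open>Both squared norms carry a factor \<open>fact (Suc k)\<close>; the product of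
    the square roots matches the factorial on the left, which then cancels.\<close>
  also have "\<dots> = rho X d \<alpha> * (sqrt (fact (Suc k)) * sqrt (fact (Suc k))) *
      sqrt ((\<Prod>i<d. real (card (A i))) * (\<Prod>i<d. real (card (A (Suc i)))))"
    unfolding \<phi>_def \<psi>_def dot_block_form_self[OF disjA trA] dot_block_form_self[OF disjB trB]
    by (simp only: real_sqrt_mult dk comp_def) (simp only: mult_ac)
  also have "\<dots> = fact (Suc k) * (rho X d \<alpha> *
      sqrt ((\<Prod>i<d. real (card (A i))) * (\<Prod>i<d. real (card (A (Suc i))))))"
    by simp
  finally show ?thesis
    unfolding r_def P_def by (subst (asm) mult_le_cancel_left_pos) simp_all
qed

end

text \<open>With \<open>P\<close> the full product, the product under the root is
  \<open>P\<^sup>2 / (a 0 * a d)\<close>, and \<open>prod_power2_le\<close> bounds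
  \<open>a 0 * a d\<close> below by \<open>P powr (2 / real (d + 1))\<close>.\<close>

lemma sqrt_shifted_prods_le:
  fixes a :: "nat \<Rightarrow> real"
  assumes d: "d \<ge> 1" and pos: "\<And>i. i \<le> d \<Longrightarrow> 0 < a i"
    and large: "\<And>i. 0 < i \<Longrightarrow> i < d \<Longrightarrow> a i \<le> a 0 \<and> a i \<le> a d"
  shows "sqrt ((\<Prod>i<d. a i) * (\<Prod>i<d. a (Suc i))) \<le> (\<Prod>i\<le>d. a i) powr (real d / real (d + 1))"
proof -
  define P where "P = (\<Prod>i\<le>d. a i)"
  have P: "0 < P" unfolding P_def by (intro prod_pos) (auto intro: pos)
  have ends: "0 < a 0 * a d" using pos d by simp
  have "P = (\<Prod>i<d. a i) * a d" "P = a 0 * (\<Prod>i<d. a (Suc i))"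
    unfolding P_def
    by (simp add: lessThan_Suc_atMost[symmetric],
        simp add: lessThan_Suc_atMost[symmetric] prod.lessThan_Suc_shift del: prod.lessThan_Suc)
  then have "((\<Prod>i<d. a i) * (\<Prod>i<d. a (Suc i))) * (a 0 * a d) = P * P"
    by (metis (no_types) mult.assoc mult.commute)
  then have prods: "(\<Prod>i<d. a i) * (\<Prod>i<d. a (Suc i)) = P\<^sup>2 / (a 0 * a d)"
    using less_imp_neq[OF ends] by (simp only: nonzero_eq_divide_eq power2_eq_square)
  have "P\<^sup>2 \<le> (a 0 * a d) ^ card {..d}"
    unfolding P_def
    by (rule prod_power2_le) (use d pos large in \<open>auto simp: less_imp_le\<close>)
  then have "P\<^sup>2 powr (1 / real (d + 1)) \<le> ((a 0 * a d) ^ (d + 1)) powr (1 / real (d + 1))"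
    by (intro powr_mono2) auto
  also have "\<dots> = a 0 * a d"
    using ends unfolding powr_realpow[OF ends, symmetric] powr_powr by simp
  finally have le: "P powr (2 / real (d + 1)) \<le> a 0 * a d"
    unfolding powr_realpow[OF P, symmetric] powr_powr by simp
  have "real d = real (d + 1) - 1" by simp
  then have exponent: "real d / real (d + 1) + real d / real (d + 1) = 2 - 2 / real (d + 1)"
    by (simp only: diff_divide_distrib) simp
  have "(P powr (real d / real (d + 1)))\<^sup>2 = P powr (2 - 2 / real (d + 1))"
    unfolding power2_eq_square powr_add[symmetric] exponent ..
  also have "\<dots> = P\<^sup>2 / P powr (2 / real (d + 1))"
    using P by (simp add: powr_diff)
  also have "\<dots> \<ge> P\<^sup>2 / (a 0 * a d)"
    using le P ends by (intro divide_left_mono) auto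
  finally have "(\<Prod>i<d. a i) * (\<Prod>i<d. a (Suc i)) \<le> (P powr (real d / real (d + 1)))\<^sup>2"
    by (simp add: prods)
  then show ?thesis
    unfolding P_def by (intro real_le_lsqrt) simp_all
qed

section \<open>Moving the two largest blocks to the ends\<close>

lemma ex_arg_max_on:
  fixes a :: "'i \<Rightarrow> 'b :: linorder"
  assumes "finite S" "S \<noteq> {}"
  obtains i where "i \<in> S" "\<And>k. k \<in> S \<Longrightarrow> a k \<le> a i"
proof -
  have "Max (a ` S) \<in> a ` S" using assms by simp
  then obtain i where "i \<in> S" "a i = Max (a ` S)" by auto
  with that[of i] assms(1) show thesis by simp
qed

lemma permutes_two_largest_to_ends:
  fixes a :: "nat \<Rightarrow> real"
  assumes d: "d \<ge> 1"
  obtains p where "p permutes {..d}"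
    "\<And>i. 0 < i \<Longrightarrow> i < d \<Longrightarrow> a (p i) \<le> a (p 0) \<and> a (p i) \<le> a (p d)"
proof -
  obtain i where i: "i \<in> {..d}" "\<And>k. k \<in> {..d} \<Longrightarrow> a k \<le> a i"
    using ex_arg_max_on[of "{..d}" a] by auto
  have "card ({..d} - {i}) = d" using i by simp
  with d have "{..d} - {i} \<noteq> {}" by force
  then obtain j where j: "j \<in> {..d} - {i}" "\<And>k. k \<in> {..d} - {i} \<Longrightarrow> a k \<le> a j"
    using ex_arg_max_on[of "{..d} - {i}" a] by auto
  \<comment> \<open>The inner swap sends \<open>d\<close> to the preimage of \<open>j\<close> under
    the outer swap. That preimage is not 0 because \<open>j \<noteq> i\<close>, so 0 still goes to
    \<open>i\<close> while \<open>d\<close> goes to \<open>j\<close>.\<close>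
  define p where "p = transpose 0 i \<circ> transpose d (transpose 0 i j)"
  have p: "p permutes {..d}"
    unfolding p_def using i j
    by (intro permutes_compose permutes_swap_id) (auto simp: transpose_def)
  have p0: "p 0 = i" and pd: "p d = j"
    using d j by (auto simp: p_def transpose_def)
  have "a (p m) \<le> a (p 0) \<and> a (p m) \<le> a (p d)" if m: "0 < m" "m < d" for m
  proof -
    have "p m \<noteq> p 0" using m permutes_inj[OF p] by (metis injD less_irrefl)
    moreover have "p m \<in> {..d}" using m permutes_in_image[OF p, of m] by simp
    ultimately show ?thesis using i j p0 pd by auto
  qed
  with that[OF p] show thesis .
qed

theorem theorem1p4:
  fixes V :: "'a set" and X :: "'a set set" and d n :: nat
    and \<alpha> :: real and A :: "nat \<Rightarrow> 'a set"
  assumes "simplicial_complex V X"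
    and "card V = n"
    and "d \<ge> 1"
    and "has_dimension X d"
    and "complete_skeleton V X d"
    and "\<And>i. i \<le> d \<Longrightarrow> A i \<subseteq> V"
    and "disjoint_family_on A {..d}"
  shows "\<bar>real (card (crossing_cells X d A)) - \<alpha> * (\<Prod>i\<le>d. real (card (A i))) / real n\<bar>
           \<le> rho X d \<alpha> * (\<Prod>i\<le>d. real (card (A i))) powr (real d / real (d + 1))"
proof (cases "\<exists>i\<le>d. A i = {}")
  \<comment> \<open>An empty block makes both sides 0, since \<open>0 powr x = 0\<close>. The other
    case has the positive sizes required by \<open>sqrt_shifted_prods_le\<close>.\<close>
  case True
  then obtain i where i: "i \<le> d" "A i = {}" by blast
  then have "crossing_cells X d A = {}" by (auto simp: crossing_cells_def)
  moreover have "(\<Prod>i\<le>d. real (card (A i))) = 0" using i by (intro prod_zero bexI[of _ i]) auto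
  ultimately show ?thesis by (simp only: card.empty) simp
next
  case False
  interpret vertex_complex V X by unfold_locales (rule assms(1))
  have cell: "cells X d \<noteq> {}" using assms(4) by (simp add: has_dimension_def)
  obtain p where p: "p permutes {..d}" and large:
    "\<And>i. 0 < i \<Longrightarrow> i < d \<Longrightarrow> real (card (A (p i))) \<le> real (card (A (p 0))) \<and>
      real (card (A (p i))) \<le> real (card (A (p d)))"
    using permutes_two_largest_to_ends[OF assms(3), of "\<lambda>i. real (card (A i))"] by blast
  have pd: "p i \<le> d \<longleftrightarrow> i \<le> d" for i using permutes_in_image[OF p, of i] by simp
  \<comment> \<open>The crossing cells and the product of the sizes do not depend on the order of
    the blocks, so the bound for \<open>B\<close> carries over to \<open>A\<close>.\<close>
  define B where "B = A \<circ> p"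
  have "disjoint_family_on B {..d}"
    unfolding disjoint_family_on_def B_def
  proof (intro ballI impI)
    fix i j assume "i \<in> {..d}" "j \<in> {..d}" "i \<noteq> j"
    then show "(A \<circ> p) i \<inter> (A \<circ> p) j = {}"
      using assms(7) pd injD[OF permutes_inj[OF p], of i j] by (auto simp: disjoint_family_on_def)
  qed
  moreover have "B i \<subseteq> V" if "i \<le> d" for i using assms(6) pd that by (simp add: B_def)
  ultimately have
    "\<bar>real (card (crossing_cells X d B)) - \<alpha> * (\<Prod>i\<le>d. real (card (B i))) / real (card V)\<bar>
      \<le> rho X d \<alpha> * sqrt ((\<Prod>i<d. real (card (B i))) * (\<Prod>i<d. real (card (B (Suc i)))))"
    by (intro abs_crossing_cells_le[OF assms(5,3) cell])
  also have "\<dots> \<le> rho X d \<alpha> * (\<Prod>i\<le>d. real (card (B i))) powr (real d / real (d + 1))"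
  proof (intro mult_left_mono sqrt_shifted_prods_le assms(3))
    \<comment> \<open>The zero cycle merely instantiates \<open>rho_nonneg\<close>, whose statement
      is made for given cycles.\<close>
    have "(\<lambda>_. 0) \<in> cycles X d"
      by (simp add: cycles_def forms_def boundary_def fun_eq_iff)
    then show "0 \<le> rho X d \<alpha>"
      using rho_nonneg[of "d - 1"] cell assms(3) by simp
  next
    fix i assume "i \<le> d"
    then have "B i \<noteq> {}" "B i \<subseteq> V" using False assms(6) pd by (auto simp: B_def)
    then show "0 < real (card (B i))"
      using finite_subset[OF _ finite_V] by (simp add: card_gt_0_iff)
  qed (use large in \<open>simp_all add: B_def\<close>)
  moreover have "crossing_cells X d B = crossing_cells X d A"
  proof -
    have "(\<forall>i\<le>d. Q (p i)) \<longleftrightarrow> (\<forall>i\<le>d. Q i)" for Q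
      using pd permutes_surj[OF p] by (metis surjD)
    from this[of "\<lambda>i. card (_ \<inter> A i) = 1"] show ?thesis
      by (simp add: crossing_cells_def B_def)
  qed
  moreover have "(\<Prod>i\<le>d. real (card (B i))) = (\<Prod>i\<le>d. real (card (A i)))"
    using prod.permute[OF p, of "\<lambda>i. real (card (A i))"] by (simp add: B_def comp_def)
  ultimately show ?thesis using assms(2) by simp
qed

end
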